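(* Let $f$ satisfy (RHS.1) and (RHS.2), and let $\chi$ satisfy (OBS.1) with respect to a given $g\in C(\partial\Omega)$. Let $w\in\mathrm{USC}(\overline\Omega)$ and $v\in\mathrm{LSC}(\overline\Omega)$ satisfy, in the viscosity sense, $\mathbb T[w;f,\chi]\le0\le\mathbb T[v;f,\chi]$ in $\Omega$. If $w\le v$ on $\partial\Omega$, then $w\le v$ in $\Omega$.
   Context: $\Omega\subset\mathbb R^d$ is a bounded domain with continuous boundary. (RHS.1) $f\in C(\Omega)\cap L^\infty(\Omega)$. (RHS.2) either $\sup_\Omega f<0$, or $\inf_\Omega f>0$, or $f\equiv0$. (OBS.1) $\chi\in C(\overline\Omega)$ and $\chi<g$ on $\partial\Omega$. For $\varphi\in C^2$: $\Delta^\diamond_\infty\varphi(x)=|D\varphi(x)|^{-2}D\varphi(x)^\intercal D^2\varphi(x)D\varphi(x)$ when $D\varphi(x)\ne0$; $\Delta^+_\infty\varphi(x)$ (resp. $\Delta^-_\infty\varphi(x)$) equals $\Delta^\diamond_\infty\varphi(x)$ if $D\varphi(x)\ne0$ and $\lambda_{\max}(D^2\varphi(x))$ (resp. $\lambda_{\min}(D^2\varphi(x))$) if $D\varphi(x)=0$. The obstacle operator is $\mathbb T[w;f,\chi](x)=\min\{-\Delta^\diamond_\infty w(x)-f(x),\,w(x)-\chi(x)\}$, interpreted in the viscosity sense: $w\in\mathrm{USC}(\overline\Omega)$ satisfies $\mathbb T[w;f,\chi]\le0$ in $\Omega$ if for every $x_0\in\Omega$ and $\varphi\in C^2$ such that $w-\varphi$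 has a local maximum at $x_0$, $\min\{-\Delta^+_\infty\varphi(x_0)-f(x_0),\,w(x_0)-\chi(x_0)\}\le0$; $v\in\mathrm{LSC}(\overline\Omega)$ satisfies $\mathbb T[v;f,\chi]\ge0$ if for every $x_0\in\Omega$ and $\varphi\in C^2$ such that $v-\varphi$ has a local minimum at $x_0$, $\min\{-\Delta^-_\infty\varphi(x_0)-f(x_0),\,v(x_0)-\chi(x_0)\}\ge0$. *)

theory Defs
  imports "HOL-Analysis.Analysis"
begin

(* Omega has continuous boundary: near every boundary point, after a rotation,
   Omega is the (strict) epigraph of a continuous function.  Encoded with a unit
   direction e and a continuous h that is constant along e (i.e. a function of the
   coordinates orthogonal to e). *)
definition continuous_boundary :: "(real^'d) set \<Rightarrow> bool" where
  "continuous_boundary \<Omega> \<longleftrightarrow>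
     (\<forall>x0\<in>frontier \<Omega>. \<exists>r>0. \<exists>e::real^'d. \<exists>h::real^'d \<Rightarrow> real.
        norm e = 1 \<and> continuous_on UNIV h \<and> (\<forall>y t. h (y + t *\<^sub>R e) = h y) \<and>
        \<Omega> \<inter> ball x0 r = {y \<in> ball x0 r. y \<bullet> e > h y})"

definition bounded_domain_cb :: "(real^'d) set \<Rightarrow> bool" where
  "bounded_domain_cb \<Omega> \<longleftrightarrow> open \<Omega> \<and> connected \<Omega> \<and> \<Omega> \<noteq> {} \<and> bounded \<Omega>
     \<and> continuous_boundary \<Omega>"

definition usc_on :: "(real^'d) set \<Rightarrow> (real^'d \<Rightarrow> real) \<Rightarrow> bool" where
  "usc_on S w \<longleftrightarrow> (\<forall>x\<in>S. \<forall>\<epsilon>>0. \<exists>\<delta>>0. \<forall>y\<in>S. dist y x < \<delta> \<longrightarrow> w y < w x + \<epsilon>)"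

definition lsc_on :: "(real^'d) set \<Rightarrow> (real^'d \<Rightarrow> real) \<Rightarrow> bool" where
  "lsc_on S v \<longleftrightarrow> (\<forall>x\<in>S. \<forall>\<epsilon>>0. \<exists>\<delta>>0. \<forall>y\<in>S. dist y x < \<delta> \<longrightarrow> v x - \<epsilon> < v y)"

definition grad :: "(real^'d \<Rightarrow> real) \<Rightarrow> real^'d \<Rightarrow> real^'d" where
  "grad \<phi> x = (THE g. (\<phi> has_derivative (\<lambda>h. g \<bullet> h)) (at x))"

definition hess :: "(real^'d \<Rightarrow> real) \<Rightarrow> real^'d \<Rightarrow> real^'d^'d" where
  "hess \<phi> x = (THE H. (grad \<phi> has_derivative (\<lambda>h. H *v h)) (at x))"

definition C2 :: "(real^'d \<Rightarrow> real) \<Rightarrow> bool" where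
  "C2 \<phi> \<longleftrightarrow> (\<forall>x. \<phi> differentiable (at x)) \<and> (\<forall>x. grad \<phi> differentiable (at x))
     \<and> continuous_on UNIV (hess \<phi>)"

definition eigenvalues_of :: "real^'d^'d \<Rightarrow> real set" where
  "eigenvalues_of A = {c. \<exists>x. x \<noteq> 0 \<and> A *v x = c *\<^sub>R x}"

definition lambda_max :: "real^'d^'d \<Rightarrow> real" where
  "lambda_max A = Max (eigenvalues_of A)"

definition lambda_min :: "real^'d^'d \<Rightarrow> real" where
  "lambda_min A = Min (eigenvalues_of A)"

definition inf_lap :: "(real^'d \<Rightarrow> real) \<Rightarrow> real^'d \<Rightarrow> real" where
  "inf_lap \<phi> x = (grad \<phi> x \<bullet> (hess \<phi> x *v grad \<phi> x)) / (norm (grad \<phi> x))\<^sup>2"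

definition inf_lap_plus :: "(real^'d \<Rightarrow> real) \<Rightarrow> real^'d \<Rightarrow> real" where
  "inf_lap_plus \<phi> x = (if grad \<phi> x \<noteq> 0 then inf_lap \<phi> x else lambda_max (hess \<phi> x))"

definition inf_lap_minus :: "(real^'d \<Rightarrow> real) \<Rightarrow> real^'d \<Rightarrow> real" where
  "inf_lap_minus \<phi> x = (if grad \<phi> x \<noteq> 0 then inf_lap \<phi> x else lambda_min (hess \<phi> x))"

definition obstacle_sub :: "(real^'d) set \<Rightarrow> (real^'d \<Rightarrow> real) \<Rightarrow> (real^'d \<Rightarrow> real)
    \<Rightarrow> (real^'d \<Rightarrow> real) \<Rightarrow> bool" where
  "obstacle_sub \<Omega> f obs w \<longleftrightarrow> usc_on (closure \<Omega>) w \<and>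
     (\<forall>x0\<in>\<Omega>. \<forall>\<phi>. C2 \<phi> \<longrightarrow>
        (\<exists>r>0. \<forall>y\<in>ball x0 r \<inter> \<Omega>. w y - \<phi> y \<le> w x0 - \<phi> x0) \<longrightarrow>
        min (- inf_lap_plus \<phi> x0 - f x0) (w x0 - obs x0) \<le> 0)"

definition obstacle_super :: "(real^'d) set \<Rightarrow> (real^'d \<Rightarrow> real) \<Rightarrow> (real^'d \<Rightarrow> real)
    \<Rightarrow> (real^'d \<Rightarrow> real) \<Rightarrow> bool" where
  "obstacle_super \<Omega> f obs v \<longleftrightarrow> lsc_on (closure \<Omega>) v \<and>
     (\<forall>x0\<in>\<Omega>. \<forall>\<phi>. C2 \<phi> \<longrightarrow>
        (\<exists>r>0. \<forall>y\<in>ball x0 r \<inter> \<Omega>. v y - \<phi> y \<ge> v x0 - \<phi> x0) \<longrightarrow>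
        min (- inf_lap_minus \<phi> x0 - f x0) (v x0 - obs x0) \<ge> 0)"

end

theory Submission
  imports Defs
begin

text \<open>Following the finite-difference method of Armstrong and Smart, the doubled function
  \<open>w y - v z\<close> is maximised over \<open>dist y z \<le> 2 \<epsilon>\<close>. If \<open>x\<close> is within \<open>\<epsilon>\<close> of both points of a
  maximising pair, comparison with quadratic cones centred at \<open>x\<close> bounds \<open>2 w y\<close> by
  \<open>w x + max w + F1 \<epsilon>\<^sup>2\<close>, the maximum being over \<open>cball x (2 \<epsilon>)\<close>, and dually \<open>2 v z\<close> from below
  with \<open>F2\<close>. Summing, and using maximality once more, gives \<open>F1 \<ge> F2\<close>. When \<open>f\<close> has a strict sign,
  rescaling \<open>v\<close> or \<open>w\<close> by \<open>1 + \<eta>\<close> makes \<open>F1 < F2\<close>, a contradiction. When \<open>f = 0\<close>, equality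
  forces \<open>(x, x)\<close> to be a maximising pair as well, with the same value of \<open>w\<close>, so such points
  can be moved indefinitely in one direction. The obstacle does not interfere: \<open>v \<ge> obs\<close> in \<open>\<Omega>\<close>, so
  \<open>w y\<close> lies well above the obstacle near a maximising pair, and the cone is started at height
  \<open>max (w x) k\<close> with \<open>k\<close> slightly larger than the obstacle, so that \<open>w\<close> can meet it only where the
  equation is active.\<close>

section \<open>Quadratic test polynomials\<close>

text \<open>A polynomial without constant term, with gradient \<alpha> e at 0 and Hessian acting as
  \<gamma> along e and as 2 \<beta> + \<gamma> on the orthogonal complement of e.\<close>

definition quad :: "real^'d \<Rightarrow> real \<Rightarrow> real \<Rightarrow> real \<Rightarrow> real^'d \<Rightarrow> real" where
  "quad e \<alpha> \<beta> \<gamma> h = \<alpha> * (e \<bullet> h) + \<beta> * (h \<bullet> h - (e \<bullet> h)\<^sup>2) + \<gamma> / 2 * (h \<bullet> h)"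

definition touched_above ::
    "(real^'d \<Rightarrow> real) \<Rightarrow> real^'d \<Rightarrow> real^'d \<Rightarrow> real \<Rightarrow> real \<Rightarrow> real \<Rightarrow> bool" where
  "touched_above u y e \<alpha> \<beta> \<gamma> \<longleftrightarrow>
     (\<exists>r>0. \<forall>h. norm h < r \<longrightarrow> u (y + h) \<le> u y + quad e \<alpha> \<beta> \<gamma> h)"

text \<open>The condition \<open>\<alpha> \<noteq> 0 \<or> \<beta> = 0\<close> ensures that \<open>\<gamma>\<close> is the infinity Laplacian of the test
  polynomial at its base point: if the gradient \<open>\<alpha> e\<close> vanishes, the Hessian is \<open>\<gamma>\<close> times the
  identity.\<close>

definition inf_sub_at :: "(real^'d \<Rightarrow> real) \<Rightarrow> real^'d \<Rightarrow> real \<Rightarrow> bool" where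
  "inf_sub_at u y F \<longleftrightarrow> (\<forall>e \<alpha> \<beta> \<gamma>. norm e = 1 \<longrightarrow> \<alpha> \<noteq> 0 \<or> \<beta> = 0 \<longrightarrow>
     touched_above u y e \<alpha> \<beta> \<gamma> \<longrightarrow> - \<gamma> \<le> F)"

lemma inf_sub_atD:
  "inf_sub_at u y F \<Longrightarrow> touched_above u y e \<alpha> \<beta> \<gamma> \<Longrightarrow> norm e = 1 \<Longrightarrow> \<alpha> \<noteq> 0 \<or> \<beta> = 0 \<Longrightarrow> - \<gamma> \<le> F"
  unfolding inf_sub_at_def by blast

lemma inf_sub_at_mono: "inf_sub_at u y F \<Longrightarrow> F \<le> G \<Longrightarrow> inf_sub_at u y G"
  unfolding inf_sub_at_def by force

section \<open>From viscosity inequalities to polynomial tests\<close>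

lemma grad_eqI:
  assumes "(\<phi> has_derivative (\<lambda>h. g \<bullet> h)) (at x)"
  shows "grad \<phi> x = g"
  unfolding grad_def
proof (rule the_equality)
  show "(\<phi> has_derivative (\<lambda>h. g \<bullet> h)) (at x)" by fact
  fix g' assume "(\<phi> has_derivative (\<lambda>h. g' \<bullet> h)) (at x)"
  from has_derivative_unique[OF this assms] have "g' \<bullet> h = g \<bullet> h" for h by meson
  then show "g' = g" using vector_eq_rdot by blast
qed

lemma hess_eqI:
  assumes "(grad \<phi> has_derivative (\<lambda>h. H *v h)) (at x)"
  shows "hess \<phi> x = H"
  unfolding hess_def
proof (rule the_equality)
  show "(grad \<phi> has_derivative (\<lambda>h. H *v h)) (at x)" by fact
  fix H' assume "(grad \<phi> has_derivative (\<lambda>h. H' *v h)) (at x)"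
  from has_derivative_unique[OF this assms] have "H' *v h = H *v h" for h by meson
  then show "H' = H" using matrix_eq by blast
qed

text \<open>For \<alpha> nonzero the normalised gradient is e up to sign, and the Hessian has
  eigenvalue \<gamma> there. For \<alpha> = 0 also \<beta> = 0, so the Hessian is \<gamma> times the
  identity and both extreme eigenvalues are \<gamma>.\<close>

lemma quad_test_function:
  fixes e y0 :: "real^'d" and \<gamma> :: real
  assumes e: "norm e = 1" and ab: "\<alpha> \<noteq> 0 \<or> \<beta> = 0"
  defines "\<phi> \<equiv> \<lambda>y. quad e \<alpha> \<beta> \<gamma> (y - y0)"
  shows "C2 \<phi>" "inf_lap_plus \<phi> y0 = \<gamma>" "inf_lap_minus \<phi> y0 = \<gamma>"
proof -
  \<comment> \<open>\<open>L\<close> is the constant Hessian as a linear map, \<open>G\<close> the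
    gradient field.\<close>
  define L where "L = (\<lambda>h::real^'d. (2 * \<beta> + \<gamma>) *\<^sub>R h - (2 * \<beta> * (e \<bullet> h)) *\<^sub>R e)"
  define G where "G = (\<lambda>y::real^'d. \<alpha> *\<^sub>R e + L (y - y0))"
  have d1: "(\<phi> has_derivative (\<lambda>h. G y \<bullet> h)) (at y)" for y
    unfolding \<phi>_def quad_def G_def L_def
    by (rule derivative_eq_intros refl | simp add: fun_eq_iff)+
       (simp add: inner_simps inner_commute power2_eq_square, simp add: field_simps)
  have gr: "grad \<phi> = G" using grad_eqI[OF d1] by auto
  have linL: "linear L"
    by (rule linearI) (auto simp: L_def algebra_simps inner_simps)
  have d2: "(G has_derivative L) (at y)" for y
    unfolding G_def L_def
    by (rule derivative_eq_intros refl | simp add: fun_eq_iff)+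
  have mL: "(*v) (matrix L) = L" using linL by (simp add: fun_eq_iff matrix_works)
  have hs: "hess \<phi> = (\<lambda>y. matrix L)"
    using hess_eqI[of \<phi> "matrix L"] d2 by (simp add: gr mL fun_eq_iff)
  show "C2 \<phi>"
    unfolding C2_def gr hs differentiable_def using d1 d2 by (blast intro: continuous_on_const)
  have Gy: "G y0 = \<alpha> *\<^sub>R e" by (simp add: G_def L_def)
  have ee: "e \<bullet> e = 1" using e by (simp add: norm_eq_1)
  have il: "inf_lap \<phi> y0 = \<gamma>" if "\<alpha> \<noteq> 0"
    using that e by (simp add: inf_lap_def gr hs Gy mL) (simp add: L_def ee algebra_simps power2_eq_square)
  have ev: "eigenvalues_of (matrix L) = {\<gamma>}" if "\<beta> = 0"
  proof -
    have "e \<noteq> 0" using e by auto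
    then show ?thesis
      unfolding eigenvalues_of_def mL using that by (auto simp: L_def)
  qed
  have nz: "e \<noteq> 0" using e by auto
  show "inf_lap_plus \<phi> y0 = \<gamma>"
  proof (cases "\<alpha> = 0")
    case True
    then show ?thesis using ev ab by (simp add: inf_lap_plus_def lambda_max_def gr hs Gy)
  qed (simp add: inf_lap_plus_def gr Gy nz il)
  show "inf_lap_minus \<phi> y0 = \<gamma>"
  proof (cases "\<alpha> = 0")
    case True
    then show ?thesis using ev ab by (simp add: inf_lap_minus_def lambda_min_def gr hs Gy)
  qed (simp add: inf_lap_minus_def gr Gy nz il)
qed

text \<open>Turns the increment form of touching into the local maximum condition of the viscosity
  definitions.\<close>

lemma touched_above_ballE:
  assumes "touched_above u x e \<alpha> \<beta> \<gamma>"
  shows "\<exists>r>0. \<forall>y\<in>ball x r \<inter> S. u y - quad e \<alpha> \<beta> \<gamma> (y - x) \<le> u x - quad e \<alpha> \<beta> \<gamma> (x - x)"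
proof -
  obtain r where r: "r > 0" "\<And>h. norm h < r \<Longrightarrow> u (x + h) \<le> u x + quad e \<alpha> \<beta> \<gamma> h"
    using assms unfolding touched_above_def by blast
  have "u y - quad e \<alpha> \<beta> \<gamma> (y - x) \<le> u x - quad e \<alpha> \<beta> \<gamma> (x - x)" if "y \<in> ball x r" for y
    using r(2)[of "y - x"] that by (simp add: dist_norm norm_minus_commute quad_def)
  with r(1) show ?thesis by blast
qed

text \<open>Strictly above the obstacle, only the first branch of the minimum can be
  nonpositive.\<close>

lemma obstacle_sub_inf_sub_at:
  fixes x :: "real^'d"
  assumes "obstacle_sub \<Omega> f obs w" "x \<in> \<Omega>" "obs x < w x"
  shows "inf_sub_at w x (f x)"
  unfolding inf_sub_at_def
proof (intro allI impI)
  fix e :: "real^'d" and \<alpha> \<beta> \<gamma>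
  assume q: "norm e = 1" "\<alpha> \<noteq> 0 \<or> \<beta> = 0" and t: "touched_above w x e \<alpha> \<beta> \<gamma>"
  note Q = quad_test_function[OF q, of \<gamma> x]
  have "min (- inf_lap_plus (\<lambda>y. quad e \<alpha> \<beta> \<gamma> (y - x)) x - f x) (w x - obs x) \<le> 0"
    using assms(1,2) Q(1) touched_above_ballE[OF t, of \<Omega>]
    unfolding obstacle_sub_def by blast
  then show "- \<gamma> \<le> f x" using assms(3) by (simp add: Q(2) min_le_iff_disj)
qed

lemma quad_uminus: "quad e (-\<alpha>) (-\<beta>) (-\<gamma>) h = - quad e \<alpha> \<beta> \<gamma> h"
  by (simp add: quad_def algebra_simps)

text \<open>The negated polynomial touches \<open>v\<close> from below, and a nonnegative minimum
  makes both branches nonnegative. The obstacle bound is obtained only at points where such touching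
  occurs.\<close>

lemma obstacle_super_touched:
  assumes "obstacle_super \<Omega> f obs v" "x \<in> \<Omega>"
    and q: "norm e = 1" "\<alpha> \<noteq> 0 \<or> \<beta> = 0" and t: "touched_above (\<lambda>y. - v y) x e \<alpha> \<beta> \<gamma>"
  shows "- \<gamma> \<le> - f x" "obs x \<le> v x"
proof -
  have q': "- \<alpha> \<noteq> 0 \<or> - \<beta> = 0" using q by auto
  note Q = quad_test_function[OF q(1) q', of "-\<gamma>" x]
  have "\<exists>r>0. \<forall>y\<in>ball x r \<inter> \<Omega>.
      v y - quad e (-\<alpha>) (-\<beta>) (-\<gamma>) (y - x) \<ge> v x - quad e (-\<alpha>) (-\<beta>) (-\<gamma>) (x - x)"
    using touched_above_ballE[OF t, of \<Omega>] unfolding quad_uminus by (simp add: algebra_simps)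
  then have "min (- inf_lap_minus (\<lambda>y. quad e (-\<alpha>) (-\<beta>) (-\<gamma>) (y - x)) x - f x) (v x - obs x) \<ge> 0"
    using assms(1,2) Q(1) unfolding obstacle_super_def by blast
  then show "- \<gamma> \<le> - f x" "obs x \<le> v x" by (simp_all add: Q(3))
qed

lemma touched_above_affine:
  assumes "a > 0" "touched_above (\<lambda>y. a * u y + b) x e \<alpha> \<beta> \<gamma>"
  shows "touched_above u x e (\<alpha> / a) (\<beta> / a) (\<gamma> / a)"
proof -
  obtain r where r: "r > 0"
    and *: "\<And>h. norm h < r \<Longrightarrow> a * u (x + h) + b \<le> a * u x + b + quad e \<alpha> \<beta> \<gamma> h"
    using assms unfolding touched_above_def by blast
  have "u (x + h) \<le> u x + quad e (\<alpha> / a) (\<beta> / a) (\<gamma> / a) h" if "norm h < r" for h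
  proof -
    have "a * quad e (\<alpha> / a) (\<beta> / a) (\<gamma> / a) h = quad e \<alpha> \<beta> \<gamma> h"
      using \<open>a > 0\<close> by (simp add: quad_def field_simps)
    then have "a * u (x + h) \<le> a * (u x + quad e (\<alpha> / a) (\<beta> / a) (\<gamma> / a) h)"
      using *[OF that] by (simp add: distrib_left)
    then show ?thesis using \<open>a > 0\<close> by simp
  qed
  with r show ?thesis unfolding touched_above_def by blast
qed

text \<open>The infinity Laplacian is positively homogeneous of degree one and ignores constants.
  This justifies the rescaling that creates a strict gap between the right-hand sides.\<close>

lemma inf_sub_at_affine:
  fixes x :: "real^'d"
  assumes a: "a > 0" and u: "inf_sub_at u x F"
  shows "inf_sub_at (\<lambda>y. a * u y + b) x (a * F)"
  unfolding inf_sub_at_def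
proof (intro allI impI)
  fix e :: "real^'d" and \<alpha> \<beta> \<gamma>
  assume "norm e = 1" "\<alpha> \<noteq> 0 \<or> \<beta> = 0" "touched_above (\<lambda>y. a * u y + b) x e \<alpha> \<beta> \<gamma>"
  then have "- (\<gamma> / a) \<le> F"
    using u touched_above_affine[OF a] a unfolding inf_sub_at_def
    by (metis divide_eq_0_iff less_irrefl)
  then show "- \<gamma> \<le> a * F" using a by (simp add: field_simps)
qed

section \<open>Semicontinuous functions on compact sets\<close>

text \<open>Without a maximum, every \<open>x\<close> has a neighbourhood on which \<open>F\<close>
  stays below some value \<open>F (z x)\<close>. For a finite subcover, the largest of these values
  would lie below another one. The metric space setting covers both points and pairs.\<close>

lemma usc_attains_max:
  fixes F :: "'a::metric_space \<Rightarrow> real"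
  assumes "compact S" "S \<noteq> {}"
    and usc: "\<And>x \<epsilon>. x \<in> S \<Longrightarrow> \<epsilon> > 0 \<Longrightarrow> \<exists>\<delta>>0. \<forall>y\<in>S. dist y x < \<delta> \<longrightarrow> F y < F x + \<epsilon>"
  shows "\<exists>x\<in>S. \<forall>y\<in>S. F y \<le> F x"
proof (rule ccontr)
  assume no: "\<not> ?thesis"
  have "\<exists>z\<in>S. \<exists>\<delta>>0. \<forall>y\<in>S. dist y x < \<delta> \<longrightarrow> F y < F z" if "x \<in> S" for x
  proof -
    have "\<exists>z\<in>S. F x < F z" using no that by (simp add: not_le)
    then obtain z where "z \<in> S" "F x < F z" by blast
    with usc[OF that, of "F z - F x"] show ?thesis by force
  qed
  then obtain z \<delta> where z: "\<And>x. x \<in> S \<Longrightarrow> z x \<in> S" "\<And>x. x \<in> S \<Longrightarrow> \<delta> x > 0"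
    "\<And>x y. x \<in> S \<Longrightarrow> y \<in> S \<Longrightarrow> dist y x < \<delta> x \<Longrightarrow> F y < F (z x)"
    by metis
  obtain T where T: "T \<subseteq> S" "finite T" "S \<subseteq> (\<Union>x\<in>T. ball x (\<delta> x))"
  proof (rule compactE_image[OF \<open>compact S\<close>, of S "\<lambda>x. ball x (\<delta> x)"])
    show "S \<subseteq> (\<Union>x\<in>S. ball x (\<delta> x))" using z(2) by force
  qed auto
  have "T \<noteq> {}" using T \<open>S \<noteq> {}\<close> by auto
  define m where "m = Max ((\<lambda>x. F (z x)) ` T)"
  have "m \<in> (\<lambda>x. F (z x)) ` T" unfolding m_def using T \<open>T \<noteq> {}\<close> by (intro Max_in) auto
  then obtain x where x: "x \<in> T" "m = F (z x)" by auto
  obtain x' where x': "x' \<in> T" "z x \<in> ball x' (\<delta> x')" using T x z(1) by blast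
  then have "F (z x) < F (z x')" using z T x by (auto simp: dist_commute subset_iff)
  also have "F (z x') \<le> m" unfolding m_def using T x' by auto
  finally show False using x by simp
qed

lemma usc_on_subset: "usc_on K u \<Longrightarrow> S \<subseteq> K \<Longrightarrow> usc_on S u"
  unfolding usc_on_def by fast

lemma usc_on_attains_max:
  assumes "usc_on S u" "compact S" "S \<noteq> {}"
  shows "\<exists>x\<in>S. \<forall>y\<in>S. u y \<le> u x"
proof (rule usc_attains_max[OF assms(2,3)])
  fix x and \<epsilon> :: real assume "x \<in> S" "\<epsilon> > 0"
  with assms(1) show "\<exists>\<delta>>0. \<forall>y\<in>S. dist y x < \<delta> \<longrightarrow> u y < u x + \<epsilon>"
    unfolding usc_on_def by blast
qed

lemma usc_on_minus_continuous:
  assumes "usc_on S u" "continuous_on S p"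
  shows "usc_on S (\<lambda>y. u y - p y)"
  unfolding usc_on_def
proof (intro ballI allI impI)
  fix x and \<epsilon> :: real assume x: "x \<in> S" "\<epsilon> > 0"
  obtain d1 where d1: "d1 > 0" "\<And>y. y \<in> S \<Longrightarrow> dist y x < d1 \<Longrightarrow> u y < u x + \<epsilon> / 2"
    using assms(1) x unfolding usc_on_def by (meson half_gt_zero)
  obtain d2 where d2: "d2 > 0" "\<And>y. y \<in> S \<Longrightarrow> dist y x < d2 \<Longrightarrow> dist (p y) (p x) < \<epsilon> / 2"
    using assms(2) x unfolding continuous_on_iff by (meson half_gt_zero)
  have *: "u y - p y < u x - p x + \<epsilon>" if "y \<in> S" "dist y x < min d1 d2" for y
    using d1(2)[of y] d2(2)[of y] that unfolding dist_real_def by linarith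
  then show "\<exists>\<delta>>0. \<forall>y\<in>S. dist y x < \<delta> \<longrightarrow> u y - p y < u x - p x + \<epsilon>"
  proof (intro exI[of _ "min d1 d2"] conjI ballI impI)
    show "0 < min d1 d2" using d1(1) d2(1) by simp
  qed (rule *)
qed

lemma lsc_on_uminus: "lsc_on S v \<longleftrightarrow> usc_on S (\<lambda>y. - v y)"
proof -
  have "v x - \<epsilon> < v y \<longleftrightarrow> - v y < - v x + \<epsilon>" for x y \<epsilon> by linarith
  then show ?thesis unfolding lsc_on_def usc_on_def by simp
qed

lemma closed_usc_superlevel:
  fixes F :: "'a::metric_space \<Rightarrow> real"
  assumes "closed S"
    and usc: "\<And>x \<epsilon>. x \<in> S \<Longrightarrow> \<epsilon> > 0 \<Longrightarrow> \<exists>\<delta>>0. \<forall>y\<in>S. dist y x < \<delta> \<longrightarrow> F y < F x + \<epsilon>"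
  shows "closed {x\<in>S. a \<le> F x}"
proof -
  have "\<exists>\<delta>>0. ball x \<delta> \<subseteq> - {x\<in>S. a \<le> F x}" if "x \<notin> {x\<in>S. a \<le> F x}" for x
  proof (cases "x \<in> S")
    case False
    then show ?thesis using \<open>closed S\<close> open_contains_ball[of "- S"] by (force simp: closed_def)
  next
    case True
    then have "a - F x > 0" using that by auto
    from usc[OF True this] obtain d where d: "d > 0" "\<forall>y\<in>S. dist y x < d \<longrightarrow> F y < F x + (a - F x)"
      by blast
    then have "ball x d \<subseteq> - {x\<in>S. a \<le> F x}" by (fastforce simp: dist_commute)
    with d show ?thesis by blast
  qed
  then show ?thesis by (auto simp: closed_def open_contains_ball)
qed

section \<open>Touching by cones and paraboloids\<close>

text \<open>For a vector \<open>\<rho> e\<close> with \<open>\<rho> > 0\<close> the norm is touched from above by a quadratic polynomial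
  whose Hessian annihilates \<open>e\<close>; this makes polynomial test functions sufficient for cones.\<close>

lemma norm_add_le_quad:
  fixes e h :: "real^'d"
  assumes "norm e = 1" "\<rho> > 0" "norm h < \<rho> / 2"
  shows "norm (\<rho> *\<^sub>R e + h) \<le> \<rho> + e \<bullet> h + (h \<bullet> h - (e \<bullet> h)\<^sup>2) / \<rho>"
proof -
  have ee: "e \<bullet> e = 1" using assms by (simp add: norm_eq_1)
  define t b where "t = e \<bullet> h" and "b = h \<bullet> h - t\<^sup>2"
  have tb: "\<bar>t\<bar> \<le> norm h" unfolding t_def using Cauchy_Schwarz_ineq2[of e h] assms by simp
  have b: "b \<ge> 0" unfolding b_def using tb by (simp add: dot_square_norm abs_le_square_iff[symmetric])
  have "norm (\<rho> *\<^sub>R e + h) ^ 2 = \<rho>^2 + 2 * \<rho> * t + h \<bullet> h"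
    unfolding power2_norm_eq_inner t_def by (simp add: inner_simps ee inner_commute power2_eq_square)
  also have "\<dots> = (\<rho> + t)^2 + b" unfolding b_def by (simp add: power2_eq_square algebra_simps)
  \<comment> \<open>The cross term 2 (\<rho> + t) b / \<rho> already absorbs b, because |t| < \<rho>
    / 2.\<close>
  also have "\<dots> \<le> (\<rho> + t + b / \<rho>)^2"
  proof -
    have "2 * (\<rho> + t) \<ge> \<rho>" using tb assms(3) abs_ge_minus_self[of t] by argo
    then have "2 * (\<rho> + t) * (b / \<rho>) \<ge> \<rho> * (b / \<rho>)" using b assms(2) by (intro mult_right_mono) auto
    then have "2 * (\<rho> + t) * (b / \<rho>) \<ge> b" using assms(2) by simp
    moreover have "(b / \<rho>)^2 \<ge> 0" by simp
    moreover have "(\<rho> + t + b / \<rho>)^2 = (\<rho> + t)^2 + 2 * (\<rho> + t) * (b / \<rho>) + (b / \<rho>)^2"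
      by (simp add: power2_sum)
    ultimately show ?thesis by linarith
  qed
  finally have "norm (\<rho> *\<^sub>R e + h) \<le> \<rho> + t + b / \<rho>"
    by (rule power2_le_imp_le) (use tb assms b in \<open>auto intro!: add_nonneg_nonneg\<close>)
  then show ?thesis by (simp add: t_def b_def)
qed

text \<open>The norm is replaced by its quadratic majorant, in the right direction since
  \<open>B\<close> is nonnegative; the squared norm is expanded exactly.\<close>

lemma cone_touched_above:
  fixes x y :: "real^'d"
  assumes "norm (y - x) < R" "y \<noteq> x" "B \<ge> 0"
    and max: "\<And>z. z \<in> cball x R \<Longrightarrow>
      u z - (B * norm (z - x) - c / 2 * (norm (z - x))\<^sup>2) \<le> u y - (B * norm (y - x) - c / 2 * (norm (y - x))\<^sup>2)"
  defines "\<rho> \<equiv> norm (y - x)"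
  shows "touched_above u y ((1 / \<rho>) *\<^sub>R (y - x)) (B - c * \<rho>) (B / \<rho>) (- c)"
proof -
  define e where "e = (1 / \<rho>) *\<^sub>R (y - x)"
  have \<rho>: "\<rho> > 0" using assms by (simp add: \<rho>_def)
  have e: "norm e = 1" using \<rho> by (simp add: e_def \<rho>_def)
  have ee: "e \<bullet> e = 1" using e by (simp add: norm_eq_1)
  have yx: "y - x = \<rho> *\<^sub>R e" using \<rho> by (simp add: e_def)
  \<comment> \<open>The first bound is for the norm majorant, the second keeps \<open>y + h\<close>
    in the ball.\<close>
  define r where "r = min (\<rho> / 2) (R - \<rho>)"
  have "u (y + h) \<le> u y + quad e (B - c * \<rho>) (B / \<rho>) (- c) h" if h: "norm h < r" for h
  proof -
    have yh: "y + h - x = \<rho> *\<^sub>R e + h" using yx by (simp add: algebra_simps)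
    have "norm (y + h - x) \<le> \<rho> + norm h" unfolding yh using e \<rho> norm_triangle_ineq[of "\<rho> *\<^sub>R e" h] by simp
    then have "y + h \<in> cball x R" using h by (simp add: r_def dist_norm norm_minus_commute)
    from max[OF this] have 1: "u (y + h) \<le> u y + B * (norm (y + h - x) - \<rho>) - c / 2 * ((norm (y + h - x))^2 - \<rho>^2)"
      unfolding \<rho>_def by (simp add: algebra_simps)
    have "norm (y + h - x) \<le> \<rho> + e \<bullet> h + (h \<bullet> h - (e \<bullet> h)\<^sup>2) / \<rho>"
      unfolding yh using norm_add_le_quad[OF e \<rho>] h by (simp add: r_def)
    then have 2: "B * (norm (y + h - x) - \<rho>) \<le> B * (e \<bullet> h + (h \<bullet> h - (e \<bullet> h)\<^sup>2) / \<rho>)"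
      using \<open>B \<ge> 0\<close> by (intro mult_left_mono) auto
    have "(norm (y + h - x))^2 = \<rho>^2 + 2 * \<rho> * (e \<bullet> h) + h \<bullet> h"
      unfolding yh power2_norm_eq_inner by (simp add: inner_simps ee inner_commute power2_eq_square)
    then have "c / 2 * ((norm (y + h - x))\<^sup>2 - \<rho>\<^sup>2) = c * \<rho> * (e \<bullet> h) + c / 2 * (h \<bullet> h)"
      by (simp add: algebra_simps)
    moreover have "quad e (B - c * \<rho>) (B / \<rho>) (- c) h =
        B * (e \<bullet> h + (h \<bullet> h - (e \<bullet> h)\<^sup>2) / \<rho>) - (c * \<rho> * (e \<bullet> h) + c / 2 * (h \<bullet> h))"
      unfolding quad_def using \<rho> by (simp add: field_simps)
    ultimately show ?thesis using 1 2 by linarith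
  qed
  moreover have "r > 0" using \<rho> assms(1) by (simp add: r_def \<rho>_def)
  ultimately show ?thesis unfolding touched_above_def e_def[symmetric] by blast
qed

lemma paraboloid_touched_above:
  fixes x z :: "real^'d"
  assumes "norm (z - x) < R"
    and max: "\<And>y. y \<in> cball x R \<Longrightarrow> u y + c / 2 * (norm (y - x))\<^sup>2 \<le> u z + c / 2 * (norm (z - x))\<^sup>2"
  shows "\<exists>e \<alpha>. norm e = 1 \<and> touched_above u z e \<alpha> 0 (- c)"
proof -
  define \<rho> where "\<rho> = norm (z - x)"
  obtain e :: "real^'d" where e: "norm e = 1" "z - x = \<rho> *\<^sub>R e"
  proof (cases "z = x")
    case True
    \<comment> \<open>At the centre the gradient vanishes, so any unit vector serves.\<close>
    then show ?thesis using that[of "axis undefined 1"] by (simp add: \<rho>_def)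
  next
    case False
    then show ?thesis using that[of "(1 / \<rho>) *\<^sub>R (z - x)"] by (simp add: \<rho>_def)
  qed
  have "u (z + h) \<le> u z + quad e (- c * \<rho>) 0 (- c) h" if h: "norm h < R - \<rho>" for h
  proof -
    have zh: "z + h - x = \<rho> *\<^sub>R e + h" using e(2) by (simp add: algebra_simps)
    have "norm (z + h - x) \<le> \<rho> + norm h"
      using norm_triangle_ineq[of "z - x" h] by (simp add: \<rho>_def algebra_simps)
    then have "z + h \<in> cball x R" using h by (simp add: dist_norm norm_minus_commute)
    from max[OF this] have 1: "u (z + h) \<le> u z + c / 2 * (norm (z - x))\<^sup>2 - c / 2 * (norm (z + h - x))\<^sup>2"
      by simp
    have "(norm (z + h - x))\<^sup>2 = \<rho>\<^sup>2 * (e \<bullet> e) + 2 * \<rho> * (e \<bullet> h) + h \<bullet> h"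
      unfolding zh power2_norm_eq_inner by (simp add: inner_simps inner_commute power2_eq_square)
    also have "e \<bullet> e = 1" using e(1) by (simp add: norm_eq_1)
    finally have "c / 2 * (norm (z + h - x))\<^sup>2 = c / 2 * (norm (z - x))\<^sup>2 - quad e (- c * \<rho>) 0 (- c) h"
      by (simp add: quad_def \<rho>_def algebra_simps)
    with 1 show ?thesis by linarith
  qed
  moreover have "R - \<rho> > 0" using assms(1) by (simp add: \<rho>_def)
  ultimately show ?thesis using e(1) unfolding touched_above_def by blast
qed

section \<open>Comparison with paraboloids and quadratic cones\<close>

text \<open>A maximiser of \<open>u\<close> plus the paraboloid does at least as well as the centre,
  which the bound on the sphere makes impossible for boundary points.\<close>

lemma usc_paraboloid_maximizer:
  fixes x :: "real^'d"
  assumes usc: "usc_on (cball x R) u" and R: "R > 0"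
    and T: "\<And>y. norm (y - x) = R \<Longrightarrow> u y + c / 2 * R\<^sup>2 < u x"
  shows "\<exists>z e \<alpha>. z \<in> ball x R \<and> u z \<ge> u x - c / 2 * (norm (z - x))\<^sup>2 \<and> norm e = 1
    \<and> touched_above u z e \<alpha> 0 (- c)"
proof -
  have "usc_on (cball x R) (\<lambda>y. u y - (- (c / 2 * (norm (y - x))\<^sup>2)))"
    by (rule usc_on_minus_continuous[OF usc]) (intro continuous_intros)
  from usc_on_attains_max[OF this compact_cball] R obtain z where z: "z \<in> cball x R"
    and max: "\<And>y. y \<in> cball x R \<Longrightarrow> u y + c / 2 * (norm (y - x))\<^sup>2 \<le> u z + c / 2 * (norm (z - x))\<^sup>2"
    by auto
  have *: "u x \<le> u z + c / 2 * (norm (z - x))\<^sup>2" using max[of x] R by simp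
  then have "norm (z - x) \<noteq> R" using T[of z] by auto
  then have zR: "norm (z - x) < R" using z by (simp add: dist_norm norm_minus_commute)
  then have "z \<in> ball x R" by (simp add: dist_norm norm_minus_commute)
  with * paraboloid_touched_above[OF zR max] show ?thesis
    by (smt (verit))
qed

text \<open>Otherwise an interior touching point would give c \<le> F. For negative right-hand sides
  this forced growth is what later makes the slope of the comparison cone nonnegative.\<close>

lemma paraboloid_growth:
  fixes x :: "real^'d"
  assumes usc: "usc_on (cball x R) u" and R: "R > 0" and c: "c < 0" "F < c"
    and T: "\<And>y. y \<in> cball x R \<Longrightarrow> u y \<le> T"
    and sub: "\<And>y. y \<in> ball x R \<Longrightarrow> u x \<le> u y \<Longrightarrow> inf_sub_at u y F"
  shows "u x - c / 2 * R\<^sup>2 \<le> T"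
proof (rule ccontr)
  assume "\<not> ?thesis"
  then have "u y + c / 2 * R\<^sup>2 < u x" if "norm (y - x) = R" for y
    using T[of y] that by (simp add: dist_norm norm_minus_commute)
  from usc_paraboloid_maximizer[OF usc R this] obtain z e \<alpha> where
    z: "z \<in> ball x R" "u z \<ge> u x - c / 2 * (norm (z - x))\<^sup>2" "norm e = 1" "touched_above u z e \<alpha> 0 (- c)"
    by blast
  have "c / 2 * (norm (z - x))\<^sup>2 \<le> 0" using c by (intro mult_nonpos_nonneg) auto
  with z(2) have "u x \<le> u z" by linarith
  from inf_sub_atD[OF sub[OF z(1) this] z(4,3)] have "- (- c) \<le> F" by simp
  with c show False by simp
qed

text \<open>If the bound fails, \<open>u\<close> minus the cone has a maximiser with value above
  \<open>A\<close>. It is neither the centre nor on the sphere, so the cone touches \<open>u\<close>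
  there with nonzero slope and gives c \<le> F. An apex height \<open>A\<close> above
  \<open>u x\<close> is allowed so that the equation is used only where \<open>u\<close> is at least
  \<open>A\<close>.\<close>

lemma cone_comparison:
  fixes x :: "real^'d"
  assumes usc: "usc_on (cball x R) u" and R: "R > 0" and B: "B \<ge> 0"
    and slope: "\<And>r. 0 < r \<Longrightarrow> r < R \<Longrightarrow> B - c * r > 0"
    and T: "\<And>y. y \<in> cball x R \<Longrightarrow> u y \<le> A + B * R - c / 2 * R\<^sup>2" and A: "u x \<le> A"
    and sub: "\<And>y. y \<in> ball x R \<Longrightarrow> A \<le> u y \<Longrightarrow> inf_sub_at u y F" and c: "F < c"
    and y: "y \<in> cball x R"
  shows "u y \<le> A + B * norm (y - x) - c / 2 * (norm (y - x))\<^sup>2"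
proof (rule ccontr)
  assume no: "\<not> ?thesis"
  define p where "p y = B * norm (y - x) - c / 2 * (norm (y - x))\<^sup>2" for y
  have "usc_on (cball x R) (\<lambda>y. u y - p y)"
    unfolding p_def by (rule usc_on_minus_continuous[OF usc]) (intro continuous_intros)
  from usc_on_attains_max[OF this compact_cball] R obtain z where z: "z \<in> cball x R"
    and max: "\<And>y. y \<in> cball x R \<Longrightarrow> u y - p y \<le> u z - p z"
    by auto
  have zA: "u z > A + p z" using max[OF y] no by (simp add: p_def)
  then have zx: "z \<noteq> x" using A by (auto simp: p_def)
  have "norm (z - x) \<noteq> R" using zA T[OF z] by (auto simp: p_def)
  then have zR: "norm (z - x) < R" using z by (simp add: dist_norm norm_minus_commute)
  have pos: "norm (z - x) > 0" using zx by simp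
  have s: "B - c * norm (z - x) > 0" using slope[OF pos zR] .
  \<comment> \<open>The left side is twice the cone increment \<open>p z\<close>.\<close>
  have "norm (z - x) * (B + (B - c * norm (z - x))) \<ge> 0"
    by (intro mult_nonneg_nonneg) (use s B in auto)
  then have "p z \<ge> 0" by (simp add: p_def algebra_simps power2_eq_square)
  then have "A \<le> u z" using zA by linarith
  moreover have "z \<in> ball x R" using zR by (simp add: dist_norm norm_minus_commute)
  ultimately have i: "inf_sub_at u z F" using sub by blast
  have t: "touched_above u z ((1 / norm (z - x)) *\<^sub>R (z - x)) (B - c * norm (z - x)) (B / norm (z - x)) (- c)"
    by (rule cone_touched_above[OF zR zx B]) (use max in \<open>simp add: p_def\<close>)
  have "norm ((1 / norm (z - x)) *\<^sub>R (z - x)) = 1" using zx by simp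
  with inf_sub_atD[OF i t] s have "- (- c) \<le> F" by simp
  with c show False by simp
qed

section \<open>The midpoint estimate\<close>

text \<open>For \<open>c > 0\<close> the quadratic cone stops increasing at radius \<open>sqrt (2 (T - A) / c)\<close>; the
  comparison has to stop there, and AM-GM recovers the same bound as on the full ball.\<close>

lemma midpoint_estimate_strict:
  fixes x :: "real^'d"
  assumes usc: "usc_on (cball x (2 * \<epsilon>)) u" and \<epsilon>: "\<epsilon> > 0" and c: "F < c" "c \<noteq> 0"
    and T: "\<And>y. y \<in> cball x (2 * \<epsilon>) \<Longrightarrow> u y \<le> T" and A: "u x \<le> A" "A \<le> T"
    and start: "u x = A \<or> A + 2 * \<bar>F\<bar> * \<epsilon>\<^sup>2 \<le> T"
    and sub: "\<And>y. y \<in> ball x (2 * \<epsilon>) \<Longrightarrow> A \<le> u y \<Longrightarrow> inf_sub_at u y F"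
    and y: "y \<in> cball x \<epsilon>"
  shows "2 * u y \<le> A + T + c * \<epsilon>\<^sup>2"
proof -
  define D where "D = T - A"
  have D: "D \<ge> 0" using A by (simp add: D_def)
  have uy: "u y \<le> T" using T[of y] y \<epsilon> by simp
  have ny: "norm (y - x) \<le> \<epsilon>" using y by (simp add: dist_norm norm_minus_commute)
  have main: ?thesis
    if R: "\<epsilon> \<le> R" "R \<le> 2 * \<epsilon>" and DR: "2 * D \<ge> c * R\<^sup>2" and slope0: "c > 0 \<or> R = 2 * \<epsilon>"
      and est: "2 * (D / R + c * R / 2) * \<epsilon> \<le> D + 2 * c * \<epsilon>\<^sup>2" and nn: "D / R + c * R / 2 \<ge> 0" for R
  proof -
    \<comment> \<open>This slope makes the cone reach height \<open>T\<close> exactly at radius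
      \<open>R\<close>.\<close>
    define B where "B = D / R + c * R / 2"
    have R0: "R > 0" using R \<epsilon> by simp
    have B0: "B \<ge> 0" using nn by (simp add: B_def)
    have "B - c * R = (2 * D - c * R\<^sup>2) / (2 * R)"
      using R0 by (simp add: B_def field_simps power2_eq_square)
    then have BR: "B - c * R \<ge> 0" using DR R0 by simp
    have slope: "B - c * r > 0" if "0 < r" "r < R" for r
    proof (cases "c > 0")
      case True
      then have "c * r < c * R" using that by simp
      then show ?thesis using BR by linarith
    next
      case False
      then have "c * r < 0" using c that by (simp add: mult_neg_pos)
      then show ?thesis using B0 by linarith
    qed
    have end_val: "A + B * R - c / 2 * R\<^sup>2 = T"
      using R0 by (simp add: B_def D_def field_simps power2_eq_square)
    have sub_ball: "cball x R \<subseteq> cball x (2 * \<epsilon>)" "ball x R \<subseteq> ball x (2 * \<epsilon>)" using R by auto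
    have "u y \<le> A + B * norm (y - x) - c / 2 * (norm (y - x))\<^sup>2"
    proof (rule cone_comparison[OF _ R0 B0 slope _ A(1) sub c(1)])
      show "usc_on (cball x R) u" using usc_on_subset[OF usc sub_ball(1)] .
      show "u z \<le> A + B * R - c / 2 * R\<^sup>2" if "z \<in> cball x R" for z
        unfolding end_val using T that sub_ball by blast
      show "y \<in> cball x R" using y R by auto
    qed (use sub_ball in auto)
    also have "A + B * norm (y - x) - c / 2 * (norm (y - x))\<^sup>2 \<le> A + B * \<epsilon> - c / 2 * \<epsilon>\<^sup>2"
    proof -
      define r where "r = norm (y - x)"
      have r: "0 \<le> r" "r \<le> \<epsilon>" using ny by (auto simp: r_def)
      \<comment> \<open>The product is twice the increment of the radial profile from r to
        \<epsilon>.\<close>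
      have "(\<epsilon> - r) * ((B - c * \<epsilon>) + (B - c * r)) \<ge> 0"
      proof (cases "c > 0")
        case True
        have "c * \<epsilon> \<le> c * R" "c * r \<le> c * R" using True R r by auto
        then show ?thesis using r BR by (intro mult_nonneg_nonneg) auto
      next
        case False
        then have "c * \<epsilon> \<le> 0" "c * r \<le> 0" using r \<epsilon> by (auto simp: mult_le_0_iff)
        then show ?thesis using r B0 by (intro mult_nonneg_nonneg) auto
      qed
      then show ?thesis unfolding r_def[symmetric] by (simp add: algebra_simps power2_eq_square)
    qed
    finally have "2 * u y \<le> 2 * A + 2 * B * \<epsilon> - c * \<epsilon>\<^sup>2" by simp
    also have "\<dots> \<le> 2 * A + (D + 2 * c * \<epsilon>\<^sup>2) - c * \<epsilon>\<^sup>2" using est by (simp add: B_def)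
    finally show ?thesis by (simp add: D_def)
  qed
  have at_2eps: ?thesis if "D \<ge> 2 * c * \<epsilon>\<^sup>2" "D / (2 * \<epsilon>) + c * (2 * \<epsilon>) / 2 \<ge> 0"
    by (rule main[of "2 * \<epsilon>"]) (use that \<epsilon> in \<open>auto simp: field_simps power2_eq_square\<close>)
  show ?thesis
  proof (cases "c > 0")
    case True
    define R where "R = sqrt (2 * D / c)"
    have cR: "c * R\<^sup>2 = 2 * D" using True D by (simp add: R_def)
    have R0: "R \<ge> 0" using True D by (simp add: R_def)
    \<comment> \<open>Below \<epsilon> the trivial bound \<open>u y \<le> T\<close> suffices; in
      between the cone is compared up to its peak; beyond 2 \<epsilon> the whole ball can be
      used.\<close>
    consider "R < \<epsilon>" | "\<epsilon> \<le> R" "R \<le> 2 * \<epsilon>" | "2 * \<epsilon> < R" by linarith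
    then show ?thesis
    proof cases
      case 1
      then have "R\<^sup>2 \<le> \<epsilon>\<^sup>2" using R0 by (intro power_mono) auto
      then have "c * R\<^sup>2 \<le> c * \<epsilon>\<^sup>2" using True by simp
      moreover have "c * \<epsilon>\<^sup>2 \<ge> 0" using True by simp
      ultimately have "D \<le> c * \<epsilon>\<^sup>2" using cR by linarith
      then show ?thesis using uy by (simp add: D_def)
    next
      case 2
      have Rpos: "R > 0" using 2 \<epsilon> by linarith
      have DR: "D / R = c * R / 2" using cR Rpos by (simp add: field_simps power2_eq_square)
      have "c * (R - 2 * \<epsilon>)\<^sup>2 \<ge> 0" using True by simp
      then have "c * R\<^sup>2 - 4 * c * R * \<epsilon> + 4 * c * \<epsilon>\<^sup>2 \<ge> 0" by (simp add: power2_eq_square algebra_simps)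
      then show ?thesis
        using main[OF 2] cR DR True Rpos D by (simp add: algebra_simps)
    next
      case 3
      then have "(2 * \<epsilon>)\<^sup>2 \<le> R\<^sup>2" using \<epsilon> by (intro power_mono) auto
      then have "c * (2 * \<epsilon>)\<^sup>2 \<le> c * R\<^sup>2" using True by simp
      then have "2 * c * \<epsilon>\<^sup>2 \<le> D" using cR by (simp add: power_mult_distrib)
      then show ?thesis using at_2eps D True \<epsilon> by simp
    qed
  next
    case False
    then have c0: "c < 0" using c by simp
    \<comment> \<open>This is nonnegativity of the cone slope for radius 2 \<epsilon>. It comes from
      quadratic growth if the apex sits at \<open>u x\<close>, and from the assumed margin if the
      apex was raised.\<close>
    have "D \<ge> - 2 * c * \<epsilon>\<^sup>2"
      using start
    proof
      assume ux: "u x = A"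
      have "u x - c / 2 * (2 * \<epsilon>)\<^sup>2 \<le> T"
        using \<epsilon> ux sub by (intro paraboloid_growth[OF usc _ c0 c(1) T]) auto
      then show ?thesis by (simp add: ux D_def power_mult_distrib)
    next
      assume "A + 2 * \<bar>F\<bar> * \<epsilon>\<^sup>2 \<le> T"
      moreover have "- c * \<epsilon>\<^sup>2 \<le> \<bar>F\<bar> * \<epsilon>\<^sup>2" using c c0 by (intro mult_right_mono) auto
      ultimately show ?thesis by (simp add: D_def algebra_simps)
    qed
    then have "D / (2 * \<epsilon>) + c * (2 * \<epsilon>) / 2 \<ge> 0"
      using \<epsilon> by (simp add: field_simps power2_eq_square)
    moreover have "2 * c * \<epsilon>\<^sup>2 \<le> 0" using c0 by (simp add: mult_le_0_iff)
    then have "D \<ge> 2 * c * \<epsilon>\<^sup>2" using D by linarith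
    ultimately show ?thesis using at_2eps by blast
  qed
qed

text \<open>The limit of the strict version as c decreases to \<open>F\<close>.\<close>

lemma midpoint_estimate:
  fixes x :: "real^'d"
  assumes usc: "usc_on (cball x (2 * \<epsilon>)) u" and \<epsilon>: "\<epsilon> > 0"
    and T: "\<And>y. y \<in> cball x (2 * \<epsilon>) \<Longrightarrow> u y \<le> T" and A: "u x \<le> A" "A \<le> T"
    and start: "u x = A \<or> A + 2 * \<bar>F\<bar> * \<epsilon>\<^sup>2 \<le> T"
    and sub: "\<And>y. y \<in> ball x (2 * \<epsilon>) \<Longrightarrow> A \<le> u y \<Longrightarrow> inf_sub_at u y F"
    and y: "y \<in> cball x \<epsilon>"
  shows "2 * u y \<le> A + T + F * \<epsilon>\<^sup>2"
proof (rule field_le_epsilon)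
  fix \<eta> :: real assume "\<eta> > 0"
  \<comment> \<open>The cap \<open>- F / 2\<close> keeps \<open>F + \<kappa>\<close> negative when
    \<open>F\<close> is negative; otherwise \<open>F + \<kappa>\<close> is positive.\<close>
  define \<kappa> where "\<kappa> = (if F < 0 then min (\<eta> / \<epsilon>\<^sup>2) (- F / 2) else \<eta> / \<epsilon>\<^sup>2)"
  have k: "F < F + \<kappa>" "F + \<kappa> \<noteq> 0" "\<kappa> \<le> \<eta> / \<epsilon>\<^sup>2"
  proof -
    have p: "\<eta> / \<epsilon>\<^sup>2 > 0" using \<open>\<eta> > 0\<close> \<epsilon> by simp
    then show "F < F + \<kappa>" "\<kappa> \<le> \<eta> / \<epsilon>\<^sup>2" by (auto simp: \<kappa>_def)
    show "F + \<kappa> \<noteq> 0" using p unfolding \<kappa>_def by (smt (verit) field_sum_of_halves)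
  qed
  have "2 * u y \<le> A + T + (F + \<kappa>) * \<epsilon>\<^sup>2"
    by (rule midpoint_estimate_strict[OF usc \<epsilon> k(1,2) T A start sub y])
  moreover have "\<kappa> * \<epsilon>\<^sup>2 \<le> \<eta>" using k(3) \<epsilon> by (simp add: field_simps)
  ultimately show "2 * u y \<le> A + T + F * \<epsilon>\<^sup>2 + \<eta>" by (simp add: algebra_simps)
qed

section \<open>Doubling of variables\<close>

text \<open>The bound on \<open>w\<close> alone serves the second maximisation, in which the first
  component is optimised among the maximising pairs.\<close>

lemma usc_on_pair:
  fixes w v :: "real^'d \<Rightarrow> real"
  assumes w: "usc_on K w" and v: "usc_on K (\<lambda>y. - v y)" and q: "q \<in> K \<times> K" and \<epsilon>: "\<epsilon> > 0"
  shows "\<exists>\<delta>>0. \<forall>p\<in>K \<times> K. dist p q < \<delta> \<longrightarrow> w (fst p) < w (fst q) + \<epsilon> \<and>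
    w (fst p) - v (snd p) < w (fst q) - v (snd q) + \<epsilon>"
proof -
  have q': "fst q \<in> K" "snd q \<in> K" using q by auto
  obtain d1 where d1: "d1 > 0" "\<And>y. y \<in> K \<Longrightarrow> dist y (fst q) < d1 \<Longrightarrow> w y < w (fst q) + \<epsilon> / 2"
    using w q'(1) \<epsilon> half_gt_zero[OF \<epsilon>] unfolding usc_on_def by blast
  obtain d2 where d2: "d2 > 0" "\<And>y. y \<in> K \<Longrightarrow> dist y (snd q) < d2 \<Longrightarrow> - v y < - v (snd q) + \<epsilon> / 2"
    using v q'(2) \<epsilon> half_gt_zero[OF \<epsilon>] unfolding usc_on_def by blast
  have "w (fst p) < w (fst q) + \<epsilon> \<and> w (fst p) - v (snd p) < w (fst q) - v (snd q) + \<epsilon>"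
    if p: "p \<in> K \<times> K" "dist p q < min d1 d2" for p
  proof -
    have "w (fst p) < w (fst q) + \<epsilon> / 2"
      using p dist_fst_le[of p q] by (intro d1(2)) auto
    moreover have "- v (snd p) < - v (snd q) + \<epsilon> / 2"
      using p dist_snd_le[of p q] by (intro d2(2)) auto
    ultimately show ?thesis using \<epsilon> by linarith
  qed
  moreover have "min d1 d2 > 0" using d1 d2 by simp
  ultimately show ?thesis by (intro exI[of _ "min d1 d2"] conjI[of "min d1 d2 > 0"] ballI impI)
qed

text \<open>Semicontinuity and the boundary inequality give a radius at each boundary point, and a
  Lebesgue number of the resulting cover makes it uniform. Since \<open>y\<close> and
  \<open>z\<close> vary independently, maximising pairs of the doubled function are kept away from
  the boundary.\<close>

lemma boundary_collar:
  fixes \<Omega> :: "(real^'d) set"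
  assumes "bounded \<Omega>" and w: "usc_on (closure \<Omega>) w" and v: "usc_on (closure \<Omega>) (\<lambda>y. - v y)"
    and bdry: "\<forall>x\<in>frontier \<Omega>. w x \<le> v x" and M: "M > 0"
  shows "\<exists>\<delta>>0. \<forall>p\<in>frontier \<Omega>. \<forall>y\<in>closure \<Omega> \<inter> ball p \<delta>. \<forall>z\<in>closure \<Omega> \<inter> ball p \<delta>. w y - v z < M"
proof -
  have fr: "compact (frontier \<Omega>)" using \<open>bounded \<Omega>\<close> by (rule compact_frontier_bounded)
  have fK: "frontier \<Omega> \<subseteq> closure \<Omega>" by (simp add: frontier_def)
  have "\<exists>d>0. \<forall>y\<in>closure \<Omega> \<inter> ball p d. \<forall>z\<in>closure \<Omega> \<inter> ball p d. w y - v z < M" if p: "p \<in> frontier \<Omega>" for p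
  proof -
    have pK: "p \<in> closure \<Omega>" using p fK by auto
    obtain d1 where d1: "d1 > 0" "\<And>y. y \<in> closure \<Omega> \<Longrightarrow> dist y p < d1 \<Longrightarrow> w y < w p + M / 2"
      using w pK half_gt_zero[OF M] unfolding usc_on_def by blast
    obtain d2 where d2: "d2 > 0" "\<And>y. y \<in> closure \<Omega> \<Longrightarrow> dist y p < d2 \<Longrightarrow> - v y < - v p + M / 2"
      using v pK half_gt_zero[OF M] unfolding usc_on_def by blast
    have "w y - v z < M" if "y \<in> closure \<Omega> \<inter> ball p (min d1 d2)" "z \<in> closure \<Omega> \<inter> ball p (min d1 d2)" for y z
      using that d1(2)[of y] d2(2)[of z] bdry[rule_format, OF p] by (simp add: dist_commute)
    moreover have "min d1 d2 > 0" using d1 d2 by simp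
    ultimately show ?thesis by blast
  qed
  then obtain d where d: "\<And>p. p \<in> frontier \<Omega> \<Longrightarrow> d p > 0"
    "\<And>p y z. p \<in> frontier \<Omega> \<Longrightarrow> y \<in> closure \<Omega> \<inter> ball p (d p) \<Longrightarrow> z \<in> closure \<Omega> \<inter> ball p (d p) \<Longrightarrow> w y - v z < M"
    by metis
  obtain e where e: "e > 0" "\<And>x. x \<in> frontier \<Omega> \<Longrightarrow> \<exists>G\<in>(\<lambda>p. ball p (d p)) ` frontier \<Omega>. ball x e \<subseteq> G"
  proof (rule Heine_Borel_lemma[OF fr, of "(\<lambda>p. ball p (d p)) ` frontier \<Omega>"])
    show "frontier \<Omega> \<subseteq> \<Union> ((\<lambda>p. ball p (d p)) ` frontier \<Omega>)" using d(1) by force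
  qed auto
  have "w y - v z < M" if "p \<in> frontier \<Omega>" "y \<in> closure \<Omega> \<inter> ball p e" "z \<in> closure \<Omega> \<inter> ball p e" for p y z
  proof -
    from e(2)[OF that(1)] obtain p' where "p' \<in> frontier \<Omega>" "ball p e \<subseteq> ball p' (d p')" by auto
    with d(2)[of p' y z] that show ?thesis by blast
  qed
  with e(1) show ?thesis by blast
qed

text \<open>Separate right-hand sides \<open>f1\<close> and \<open>f2\<close> allow either function
  to have been rescaled beforehand. A uniform gap contradicts the summed midpoint estimates; two
  zero right-hand sides lead to the translation argument.\<close>

lemma doubling_comparison:
  fixes \<Omega> :: "(real^'d) set"
  assumes bnd: "bounded \<Omega>" and "open \<Omega>"
    and w: "usc_on (closure \<Omega>) w" and v: "usc_on (closure \<Omega>) (\<lambda>y. - v y)"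
    and bdry: "\<forall>x\<in>frontier \<Omega>. w x \<le> v x"
    and obs: "continuous_on (closure \<Omega>) obs" and obs_v: "\<And>x. x \<in> \<Omega> \<Longrightarrow> obs x \<le> v x"
    and f: "continuous_on \<Omega> f1" "continuous_on \<Omega> f2" and C: "\<And>x. x \<in> \<Omega> \<Longrightarrow> \<bar>f1 x\<bar> \<le> C"
    and sub: "\<And>y. y \<in> \<Omega> \<Longrightarrow> obs y < w y \<Longrightarrow> inf_sub_at w y (f1 y)"
    and super: "\<And>y. y \<in> \<Omega> \<Longrightarrow> inf_sub_at (\<lambda>y. - v y) y (- f2 y)"
    and gap: "(\<exists>\<delta>>0. \<forall>x\<in>\<Omega>. f1 x + \<delta> \<le> f2 x) \<or> (\<forall>x\<in>\<Omega>. f1 x = 0 \<and> f2 x = 0)"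
    and x1: "x1 \<in> \<Omega>"
  shows "w x1 \<le> v x1"
proof (rule ccontr)
  define K where "K = closure \<Omega>"
  define M where "M = w x1 - v x1"
  assume "\<not> w x1 \<le> v x1"
  then have M: "M > 0" by (simp add: M_def)
  have K: "compact K" "closed K" "\<Omega> \<subseteq> K" "frontier \<Omega> \<subseteq> K"
    using bnd by (auto simp: K_def closure_subset frontier_def)
  obtain \<delta> where \<delta>: "\<delta> > 0"
    "\<And>p y z. p \<in> frontier \<Omega> \<Longrightarrow> y \<in> K \<Longrightarrow> y \<in> ball p \<delta> \<Longrightarrow> z \<in> K \<Longrightarrow> z \<in> ball p \<delta> \<Longrightarrow> w y - v z < M"
    using boundary_collar[OF bnd w v bdry M] unfolding K_def by blast
  \<comment> \<open>A compact part of \<Omega>, on which \<open>f1\<close> and \<open>f2\<close> are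
    uniformly continuous.\<close>
  define K' where "K' = {x\<in>K. \<forall>p\<in>frontier \<Omega>. \<delta> / 4 \<le> dist p x}"
  have "K' = K \<inter> (\<Inter>p\<in>frontier \<Omega>. {x. \<delta> / 4 \<le> dist p x})" by (auto simp: K'_def)
  moreover have "closed (\<Inter>p\<in>frontier \<Omega>. {x. \<delta> / 4 \<le> dist p x})"
    by (intro closed_INT ballI closed_Collect_le continuous_intros)
  ultimately have K': "compact K'" using K(1) by (simp add: compact_Int_closed)
  have K'\<Omega>: "K' \<subseteq> \<Omega>"
  proof
    fix x assume x: "x \<in> K'"
    have "x \<notin> frontier \<Omega>" using x \<delta>(1) by (force simp: K'_def)
    then show "x \<in> \<Omega>" using x \<open>open \<Omega>\<close> by (auto simp: K'_def K_def frontier_def interior_open)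
  qed
  obtain \<rho>1 where \<rho>1: "\<rho>1 > 0" "\<And>x y. x \<in> K \<Longrightarrow> y \<in> K \<Longrightarrow> dist x y < \<rho>1 \<Longrightarrow> \<bar>obs x - obs y\<bar> < M / 3"
  proof -
    have "uniformly_continuous_on K obs"
      using compact_uniformly_continuous obs K(1) unfolding K_def by blast
    moreover have "M / 3 > 0" using M by simp
    ultimately obtain r where r: "r > 0"
      "\<forall>x\<in>K. \<forall>y\<in>K. dist y x < r \<longrightarrow> dist (obs y) (obs x) < M / 3"
      unfolding uniformly_continuous_on_def by blast
    then show ?thesis using that[OF r(1)] unfolding dist_real_def by simp
  qed
  \<comment> \<open>On small balls the right-hand sides are replaced by constants. Each replacement
    costs a third of the gap, so strict inequality survives.\<close>
  obtain \<rho>2 C' where \<rho>2: "\<rho>2 > 0" "C' \<ge> 0"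
    "\<And>\<epsilon> x. 2 * \<epsilon> < \<rho>2 \<Longrightarrow> \<epsilon> > 0 \<Longrightarrow> cball x (2 * \<epsilon>) \<subseteq> K' \<Longrightarrow> \<exists>F1 F2. \<bar>F1\<bar> \<le> C' \<and>
      (\<forall>y\<in>cball x (2 * \<epsilon>). f1 y \<le> F1 \<and> F2 \<le> f2 y) \<and> (F1 < F2 \<or> F1 = 0 \<and> F2 = 0)"
    using gap
  proof (elim disjE exE conjE)
    assume "\<forall>x\<in>\<Omega>. f1 x = 0 \<and> f2 x = 0"
    then have "\<exists>F1 F2. \<bar>F1\<bar> \<le> (0::real) \<and> (\<forall>y\<in>cball x (2 * \<epsilon>). f1 y \<le> F1 \<and> F2 \<le> f2 y) \<and> (F1 < F2 \<or> F1 = 0 \<and> F2 = 0)"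
      if "cball x (2 * \<epsilon>) \<subseteq> K'" for x \<epsilon>
      using that K'\<Omega> by (intro exI[of _ 0]) auto
    then show thesis using that[of 1 0] by auto
  next
    fix d assume d: "d > 0" "\<forall>x\<in>\<Omega>. f1 x + d \<le> f2 x"
    have d3: "d / 3 > 0" using d by simp
    have uc: "uniformly_continuous_on K' f1" "uniformly_continuous_on K' f2"
      using f K'\<Omega> by (auto intro!: compact_uniformly_continuous K' elim: continuous_on_subset)
    obtain r1 where r1: "r1 > 0"
      "\<And>x y. x \<in> K' \<Longrightarrow> y \<in> K' \<Longrightarrow> dist y x < r1 \<Longrightarrow> \<bar>f1 y - f1 x\<bar> < d / 3"
      using uc(1) d3 unfolding uniformly_continuous_on_def dist_real_def by blast
    obtain r2 where r2: "r2 > 0"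
      "\<And>x y. x \<in> K' \<Longrightarrow> y \<in> K' \<Longrightarrow> dist y x < r2 \<Longrightarrow> \<bar>f2 y - f2 x\<bar> < d / 3"
      using uc(2) d3 unfolding uniformly_continuous_on_def dist_real_def by blast
    note r = r1(1) r2(1) r1(2) r2(2)
    show thesis
    proof (rule that[of "min r1 r2" "C + d"])
      show "min r1 r2 > 0" using r by simp
      show "C + d \<ge> 0" using C[OF x1] d by linarith
      fix \<epsilon> x assume \<epsilon>: "2 * \<epsilon> < min r1 r2" "\<epsilon> > 0" and sub: "cball x (2 * \<epsilon>) \<subseteq> K'"
      have xK: "x \<in> K'" using sub \<epsilon> by auto
      then have x\<Omega>: "x \<in> \<Omega>" using K'\<Omega> by auto
      show "\<exists>F1 F2. \<bar>F1\<bar> \<le> C + d \<and>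
        (\<forall>y\<in>cball x (2 * \<epsilon>). f1 y \<le> F1 \<and> F2 \<le> f2 y) \<and> (F1 < F2 \<or> F1 = 0 \<and> F2 = 0)"
      proof (rule exI[of _ "f1 x + d / 3"], rule exI[of _ "f2 x - d / 3"], intro conjI ballI)
        show "\<bar>f1 x + d / 3\<bar> \<le> C + d" using C[OF x\<Omega>] d by linarith
        show "f1 x + d / 3 < f2 x - d / 3 \<or> f1 x + d / 3 = 0 \<and> f2 x - d / 3 = 0"
          using d(1) d(2)[rule_format, OF x\<Omega>] by linarith
        fix y assume y: "y \<in> cball x (2 * \<epsilon>)"
        then have "y \<in> K'" "dist y x < r1" "dist y x < r2" using sub \<epsilon> by (auto simp: dist_commute)
        from r(3)[OF xK this(1,2)] r(4)[OF xK this(1,3)]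
        show "f1 y \<le> f1 x + d / 3" "f2 x - d / 3 \<le> f2 y" by linarith+
      qed
    qed
  qed
  \<comment> \<open>In order: balls of radius 2 \<epsilon> avoid the boundary, \<open>obs\<close>
    varies on them by less than M / 3, constants \<open>F1\<close> and \<open>F2\<close> exist, and
    the last two bounds make the error \<open>2 * C' * \<epsilon>\<^sup>2\<close> at most M /
    3.\<close>
  define \<epsilon> where "\<epsilon> = Min {\<delta> / 8, \<rho>1 / 3, \<rho>2 / 3, 1, M / (6 * (C' + 1))}"
  have "\<epsilon> > 0" using \<delta>(1) \<rho>1(1) \<rho>2(1,2) M by (simp add: \<epsilon>_def)
  moreover have "\<epsilon> \<le> \<delta> / 8" "\<epsilon> \<le> \<rho>1 / 3" "\<epsilon> \<le> \<rho>2 / 3" "\<epsilon> \<le> 1" "\<epsilon> \<le> M / (6 * (C' + 1))"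
    unfolding \<epsilon>_def by (rule Min_le; simp)+
  ultimately have \<epsilon>: "\<epsilon> > 0" "\<epsilon> \<le> \<delta> / 8" "\<epsilon> \<le> \<rho>1 / 3" "\<epsilon> \<le> \<rho>2 / 3" "\<epsilon> \<le> 1"
    "\<epsilon> \<le> M / (6 * (C' + 1))" by blast+
  have \<epsilon>C: "2 * C' * \<epsilon>\<^sup>2 \<le> M / 3"
  proof -
    have "\<epsilon>\<^sup>2 \<le> \<epsilon>" using \<epsilon>(1,5) by (simp add: power2_eq_square mult_left_le)
    then have "2 * C' * \<epsilon>\<^sup>2 \<le> 2 * C' * \<epsilon>" using \<rho>2(2) by (intro mult_left_mono) auto
    also have "\<dots> \<le> 2 * (C' + 1) * \<epsilon>" using \<epsilon>(1) by simp
    also have "\<dots> \<le> M / 3" using \<epsilon>(6) \<rho>2(2) by (simp add: field_simps)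
    finally show ?thesis .
  qed

  define P where "P = {p \<in> K \<times> K. dist (fst p) (snd p) \<le> 2 * \<epsilon>}"
  have "P = (K \<times> K) \<inter> {p. dist (fst p) (snd p) \<le> 2 * \<epsilon>}" by (auto simp: P_def)
  moreover have "closed {p :: (real^'d) \<times> (real^'d). dist (fst p) (snd p) \<le> 2 * \<epsilon>}"
    by (intro closed_Collect_le continuous_intros)
  ultimately have P: "compact P" using K(1) by (simp add: compact_Int_closed compact_Times)
  have x1P: "(x1, x1) \<in> P" using x1 K(3) \<epsilon>(1) by (auto simp: P_def)
  have uscP: "\<exists>\<delta>>0. \<forall>p\<in>P. dist p q < \<delta> \<longrightarrow> w (fst p) < w (fst q) + \<eta>"
    "\<exists>\<delta>>0. \<forall>p\<in>P. dist p q < \<delta> \<longrightarrow> w (fst p) - v (snd p) < w (fst q) - v (snd q) + \<eta>"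
    if "q \<in> P" "\<eta> > 0" for q \<eta>
  proof -
    have "q \<in> closure \<Omega> \<times> closure \<Omega>" using that(1) unfolding P_def K_def by simp
    from usc_on_pair[OF w v this that(2)] obtain d where d: "d > 0" "\<forall>p\<in>K \<times> K. dist p q < d \<longrightarrow> w (fst p) < w (fst q) + \<eta> \<and>
      w (fst p) - v (snd p) < w (fst q) - v (snd q) + \<eta>" unfolding K_def by blast
    have "P \<subseteq> K \<times> K" by (auto simp: P_def)
    with d show "\<exists>\<delta>>0. \<forall>p\<in>P. dist p q < \<delta> \<longrightarrow> w (fst p) < w (fst q) + \<eta>"
      "\<exists>\<delta>>0. \<forall>p\<in>P. dist p q < \<delta> \<longrightarrow> w (fst p) - v (snd p) < w (fst q) - v (snd q) + \<eta>"
      by blast+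
  qed
  obtain q where q: "q \<in> P" "\<forall>p\<in>P. w (fst p) - v (snd p) \<le> w (fst q) - v (snd q)"
    using usc_attains_max[OF P, of "\<lambda>p. w (fst p) - v (snd p)"] uscP(2) x1P by blast
  define N where "N = w (fst q) - v (snd q)"
  have NM: "M \<le> N" using q(2)[rule_format, OF x1P] by (simp add: N_def M_def)
  have Nmax: "w y - v z \<le> N" if "y \<in> K" "z \<in> K" "dist y z \<le> 2 * \<epsilon>" for y z
    using q(2)[rule_format, of "(y, z)"] that by (simp add: P_def N_def)
  define S where "S = {p\<in>P. N \<le> w (fst p) - v (snd p)}"
  have "closed S" unfolding S_def
    using closed_usc_superlevel[OF compact_imp_closed[OF P], of "\<lambda>p. w (fst p) - v (snd p)"] uscP(2) by blast
  moreover have "S \<subseteq> P" by (auto simp: S_def)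
  ultimately have S: "compact S" using P compact_Int_closed[OF P, of S] by (simp add: Int_absorb1)
  have qS: "q \<in> S" using q(1) by (simp add: S_def N_def)
  \<comment> \<open>Among maximising pairs, one with the largest value of \<open>w\<close> is
    chosen; this extremality propagates in the case of zero right-hand sides.\<close>
  have "\<exists>p\<in>S. \<forall>p'\<in>S. w (fst p') \<le> w (fst p)"
  proof (rule usc_attains_max[OF S])
    show "S \<noteq> {}" using qS by auto
    fix p and \<eta> :: real assume "p \<in> S" "\<eta> > 0"
    then show "\<exists>\<delta>>0. \<forall>y\<in>S. dist y p < \<delta> \<longrightarrow> w (fst y) < w (fst p) + \<eta>"
      using uscP(1)[of p \<eta>] \<open>S \<subseteq> P\<close> by blast
  qed
  then obtain p where p: "p \<in> S" "\<And>p'. p' \<in> S \<Longrightarrow> w (fst p') \<le> w (fst p)" by blast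
  define W where "W = w (fst p)"

  \<comment> \<open>Propagation: every x within \<epsilon> of both points of an extremal pair yields
    an extremal pair (x, x).\<close>
  have step: "x \<in> K \<and> w x = W \<and> v x = W - N"
    if yz: "y \<in> K" "z \<in> K" "y \<in> cball x \<epsilon>" "z \<in> cball x \<epsilon>" "w y - v z = N" "w y = W" for x y z
  proof -
    \<comment> \<open>A closer boundary point would put \<open>y\<close> and \<open>z\<close> into
      its collar, although their doubled value N is at least M.\<close>
    have far: "7 * \<delta> / 8 \<le> dist b x" if b: "b \<in> frontier \<Omega>" for b
    proof (rule ccontr)
      assume "\<not> ?thesis"
      then have "y \<in> ball b \<delta>" "z \<in> ball b \<delta>"
        using yz(3,4) \<epsilon>(2) dist_triangle[of b y x] dist_triangle[of b z x] by auto
      with \<delta>(2)[OF b] yz NM show False by force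
    qed
    have far2: "\<delta> / 4 \<le> dist b y'" if "b \<in> frontier \<Omega>" "y' \<in> cball x (2 * \<epsilon>)" for b y'
      using far[OF that(1)] that(2) \<epsilon>(2) \<delta>(1) dist_triangle[of b x y'] by (simp add: dist_commute)
    have cbK: "cball x (2 * \<epsilon>) \<subseteq> K"
    proof (rule ccontr)
      assume "\<not> ?thesis"
      moreover have "y \<in> cball x (2 * \<epsilon>) \<inter> K" using yz \<epsilon>(1) by auto
      \<comment> \<open>A connected ball that meets \<open>K\<close> and leaves it must cross the
        frontier.\<close>
      ultimately have "cball x (2 * \<epsilon>) \<inter> frontier K \<noteq> {}"
        by (intro connected_Int_frontier) auto
      moreover have "frontier K \<subseteq> frontier \<Omega>"
        using interior_mono[OF closure_subset[of \<Omega>]] by (auto simp: K_def frontier_def)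
      ultimately obtain b where "b \<in> cball x (2 * \<epsilon>)" "b \<in> frontier \<Omega>" by blast
      with far2[of b b] \<delta>(1) show False by simp
    qed
    then have cbK': "cball x (2 * \<epsilon>) \<subseteq> K'" using far2 by (auto simp: K'_def)
    then have cb\<Omega>: "cball x (2 * \<epsilon>) \<subseteq> \<Omega>" using K'\<Omega> by blast
    have xcb: "x \<in> cball x (2 * \<epsilon>)" "cball x (2 * \<epsilon>) \<noteq> {}" using \<epsilon>(1) by auto
    obtain F1 F2 where F: "\<bar>F1\<bar> \<le> C'" "\<And>y. y \<in> cball x (2 * \<epsilon>) \<Longrightarrow> f1 y \<le> F1 \<and> F2 \<le> f2 y"
      "F1 < F2 \<or> F1 = 0 \<and> F2 = 0"
      using \<rho>2(3)[OF _ \<epsilon>(1) cbK'] \<epsilon>(4) \<rho>2(1) by force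
    have wB: "usc_on (cball x (2 * \<epsilon>)) w" and vB: "usc_on (cball x (2 * \<epsilon>)) (\<lambda>y. - v y)"
      using usc_on_subset[OF w] usc_on_subset[OF v] cbK unfolding K_def by blast+
    obtain y2 where y2: "y2 \<in> cball x (2 * \<epsilon>)" "\<And>y. y \<in> cball x (2 * \<epsilon>) \<Longrightarrow> w y \<le> w y2"
      using usc_on_attains_max[OF wB compact_cball xcb(2)] by blast
    obtain z2 where z2: "z2 \<in> cball x (2 * \<epsilon>)" "\<And>y. y \<in> cball x (2 * \<epsilon>) \<Longrightarrow> - v y \<le> - v z2"
      using usc_on_attains_max[OF vB compact_cball xcb(2)] by blast
    \<comment> \<open>\<open>k\<close> exceeds the obstacle on the whole ball, so the equation for
      \<open>w\<close> is active wherever \<open>w\<close> is at least \<open>A\<close>.\<close>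
    define k where "k = obs x + M / 3"
    define A where "A = max (w x) k"
    have osc: "obs y' < obs x + M / 3" "obs x - M / 3 < obs y'" if "y' \<in> cball x (2 * \<epsilon>)" for y'
    proof -
      have "\<bar>obs y' - obs x\<bar> < M / 3"
        using that cbK xcb \<epsilon>(1,3) by (intro \<rho>1(2)) (auto simp: dist_commute)
      then show "obs y' < obs x + M / 3" "obs x - M / 3 < obs y'"
        unfolding abs_less_iff by linarith+
    qed
    have zc: "z \<in> cball x (2 * \<epsilon>)" "y \<in> cball x (2 * \<epsilon>)" using yz \<epsilon>(1) by auto
    \<comment> \<open>Here \<open>w y = N + v z\<close> with \<open>v z\<close> above the obstacle,
      leaving a margin of M / 3 over \<open>k\<close>.\<close>
    have kT: "k + M / 3 \<le> w y2"
    proof -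
      have "obs z \<le> v z" using obs_v zc cb\<Omega> by blast
      then show ?thesis using osc(2)[OF zc(1)] y2(2)[OF zc(2)] yz(5) NM unfolding k_def by linarith
    qed
    have FC: "2 * \<bar>F1\<bar> * \<epsilon>\<^sup>2 \<le> M / 3"
    proof -
      have "2 * \<bar>F1\<bar> * \<epsilon>\<^sup>2 \<le> 2 * C' * \<epsilon>\<^sup>2" using F(1) by (intro mult_right_mono) auto
      with \<epsilon>C show ?thesis by linarith
    qed
    have e1: "2 * w y \<le> A + w y2 + F1 * \<epsilon>\<^sup>2"
    proof (rule midpoint_estimate[OF wB \<epsilon>(1) y2(2)])
      show "w x \<le> A" by (simp add: A_def)
      show "A \<le> w y2" using y2(2)[OF xcb(1)] kT M by (simp add: A_def)
      show "w x = A \<or> A + 2 * \<bar>F1\<bar> * \<epsilon>\<^sup>2 \<le> w y2" using kT FC by (auto simp: A_def max_def)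
      show "y \<in> cball x \<epsilon>" by fact
      fix y' assume y': "y' \<in> ball x (2 * \<epsilon>)" "A \<le> w y'"
      then have y'c: "y' \<in> cball x (2 * \<epsilon>)" by auto
      then have "obs y' < w y'" using osc(1)[OF y'c] y'(2) by (simp add: A_def k_def)
      then have "inf_sub_at w y' (f1 y')" using sub y'c cb\<Omega> by blast
      then show "inf_sub_at w y' F1" using inf_sub_at_mono F(2)[OF y'c] by blast
    qed auto
    have e2: "2 * (- v z) \<le> - v x + (- v z2) + (- F2) * \<epsilon>\<^sup>2"
    proof (rule midpoint_estimate[OF vB \<epsilon>(1) z2(2)])
      show "z \<in> cball x \<epsilon>" by fact
      show "- v x \<le> - v z2" using z2(2)[OF xcb(1)] .
      fix y' assume "y' \<in> ball x (2 * \<epsilon>)"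
      then have y'c: "y' \<in> cball x (2 * \<epsilon>)" by auto
      then have "inf_sub_at (\<lambda>y. - v y) y' (- f2 y')" using super cb\<Omega> by blast
      then show "inf_sub_at (\<lambda>y. - v y) y' (- F2)"
        by (rule inf_sub_at_mono) (use F(2)[OF y'c] in simp)
    qed auto
    \<comment> \<open>Points of the ball are within 2 \<epsilon> of its centre and so form
      admissible pairs with it.\<close>
    have n1: "w y2 - v x \<le> N" using y2(1) xcb cbK by (intro Nmax) (auto simp: dist_commute)
    have n2: "w x - v z2 \<le> N" using z2(1) xcb cbK by (intro Nmax) (auto simp: dist_commute)
    have "obs z2 \<le> v z2" using obs_v z2(1) cb\<Omega> by blast
    \<comment> \<open>Strictness rules out \<open>A = k\<close> once equality holds below.\<close>
    then have n3: "k - v z2 < N" using osc(2)[OF z2(1)] NM M unfolding k_def by linarith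
    have n4: "A - v z2 \<le> N" using n2 n3 by (simp add: A_def max_def)
    have sum: "2 * N \<le> (A - v z2) + (w y2 - v x) + (F1 - F2) * \<epsilon>\<^sup>2"
      using e1 e2 yz(5) by (simp add: algebra_simps)
    have F0: "F1 = 0" "F2 = 0"
    proof -
      have "(F1 - F2) * \<epsilon>\<^sup>2 \<ge> 0" using sum n1 n4 by linarith
      then have "F1 \<ge> F2" using \<epsilon>(1) by (simp add: zero_le_mult_iff)
      with F(3) show "F1 = 0" "F2 = 0" by auto
    qed
    \<comment> \<open>With no error term left, both upper bounds by N must be equalities.\<close>
    have eqs: "A - v z2 = N" "w y2 - v x = N" using sum n1 n4 F0 by auto
    then have Aw: "A = w x" using n3 by (auto simp: A_def max_def split: if_splits)
    have "2 * w y = w x + w y2" using e1 e2 eqs Aw yz(5) F0 by simp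
    moreover have "w y2 = W"
    proof -
      have "(y2, x) \<in> S" using eqs(2) y2(1) xcb(1) cbK by (auto simp: S_def P_def dist_commute)
      then have "w y2 \<le> W" using p(2) by (force simp: W_def)
      moreover have "W \<le> w y2" using y2(2)[OF zc(2)] yz(6) by simp
      ultimately show ?thesis by simp
    qed
    ultimately show ?thesis using yz(6) eqs(2) xcb(1) cbK by auto
  qed

  \<comment> \<open>Superlevel sets are closed, and maximality of N and W turns both inequalities
    into equalities.\<close>
  define G where "G = {x\<in>K. W \<le> w x} \<inter> {x\<in>K. N - W \<le> - v x}"
  have "closed {x\<in>K. W \<le> w x}" "closed {x\<in>K. N - W \<le> - v x}"
    by (rule closed_usc_superlevel[OF K(2)]; use w v in \<open>simp add: usc_on_def K_def\<close>)+
  then have "compact (K \<inter> G)" using K(1) by (auto simp: G_def)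
  moreover have "K \<inter> G = G" by (auto simp: G_def)
  ultimately have "compact G" by simp
  have pK: "fst p \<in> K" "snd p \<in> K" "dist (fst p) (snd p) \<le> 2 * \<epsilon>" "N \<le> w (fst p) - v (snd p)"
    using p(1) unfolding S_def P_def by auto
  have pN: "w (fst p) - v (snd p) = N" using Nmax[OF pK(1-3)] pK(4) by simp
  \<comment> \<open>The midpoint is within \<epsilon> of both points of the chosen pair and gives a
    first element of \<open>G\<close>.\<close>
  have "midpoint (fst p) (snd p) \<in> K \<and> w (midpoint (fst p) (snd p)) = W \<and>
      v (midpoint (fst p) (snd p)) = W - N"
    by (rule step[OF pK(1,2) _ _ pN]) (use pK(3) in \<open>simp_all add: dist_midpoint W_def\<close>)
  then have "midpoint (fst p) (snd p) \<in> G" by (simp add: G_def)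
  then have "G \<noteq> {}" by blast
  define a :: "real^'d" where "a = axis undefined 1"
  have a: "norm a = 1" "a \<bullet> a = 1" by (simp_all add: a_def norm_eq_1)
  have "continuous_on G (\<lambda>x. x \<bullet> a)" by (intro continuous_intros)
  \<comment> \<open>A point of \<open>G\<close> farthest in direction \<open>a\<close> cannot exist,
    since propagation moves it by \<epsilon> along \<open>a\<close> within \<open>G\<close>.\<close>
  from continuous_attains_sup[OF \<open>compact G\<close> \<open>G \<noteq> {}\<close> this]
  obtain x0 where x0: "x0 \<in> G" "\<forall>y\<in>G. y \<bullet> a \<le> x0 \<bullet> a" by blast
  have x0K: "x0 \<in> K" "W \<le> w x0" "v x0 \<le> W - N" using x0(1) by (auto simp: G_def)
  have n: "w x0 - v x0 \<le> N" using Nmax[OF x0K(1) x0K(1)] \<epsilon>(1) by simp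
  have "x0 + \<epsilon> *\<^sub>R a \<in> K \<and> w (x0 + \<epsilon> *\<^sub>R a) = W \<and> v (x0 + \<epsilon> *\<^sub>R a) = W - N"
  proof (rule step[OF x0K(1) x0K(1)])
    show "x0 \<in> cball (x0 + \<epsilon> *\<^sub>R a) \<epsilon>" using a(1) \<epsilon>(1) by (simp add: dist_norm)
    then show "x0 \<in> cball (x0 + \<epsilon> *\<^sub>R a) \<epsilon>" .
    show "w x0 - v x0 = N" using n x0K by simp
    have "(x0, x0) \<in> S" using x0K \<epsilon>(1) by (simp add: S_def P_def)
    from p(2)[OF this] x0K(2) show "w x0 = W" by (simp add: W_def)
  qed
  then have "x0 + \<epsilon> *\<^sub>R a \<in> G" by (simp add: G_def)
  then have "(x0 + \<epsilon> *\<^sub>R a) \<bullet> a \<le> x0 \<bullet> a" using x0(2) by blast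
  then show False using a \<epsilon>(1) by (simp add: inner_simps)
qed

section \<open>Reduction to the doubling comparison\<close>

text \<open>\<open>v\<close> need not admit a test polynomial at x itself. A steep paraboloid
  touches it at a nearby z with \<open>v z \<le> v x\<close>, where the obstacle inequality is
  available; continuity of \<open>obs\<close> then gives the contradiction.\<close>

lemma obstacle_le_super:
  fixes \<Omega> :: "(real^'d) set"
  assumes sup: "obstacle_super \<Omega> f obs v" and "open \<Omega>" and obs: "continuous_on \<Omega> obs" and x: "x \<in> \<Omega>"
  shows "obs x \<le> v x"
proof (rule ccontr)
  assume "\<not> ?thesis"
  then have vx: "obs x - v x > 0" by simp
  obtain r1 where r1: "r1 > 0" "\<And>y. y \<in> \<Omega> \<Longrightarrow> dist y x < r1 \<Longrightarrow> dist (obs y) (obs x) < obs x - v x"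
    using obs x vx unfolding continuous_on_iff by blast
  obtain r2 where r2: "r2 > 0" "cball x r2 \<subseteq> \<Omega>"
    using \<open>open \<Omega>\<close> x open_contains_cball by blast
  define R where "R = min (r1 / 2) r2"
  have R: "R > 0" "cball x R \<subseteq> \<Omega>" using r1 r2 by (auto simp: R_def)
  have big: "v x < obs y" if "y \<in> cball x R" for y
    using r1(2)[of y] that R r1(1) by (auto simp: R_def dist_commute dist_real_def abs_less_iff)
  have "usc_on (closure \<Omega>) (\<lambda>y. - v y)"
    using sup unfolding obstacle_super_def lsc_on_uminus by blast
  then have usc: "usc_on (cball x R) (\<lambda>y. - v y)"
    using R(2) closure_subset by (blast intro: usc_on_subset)
  have "cball x R \<noteq> {}" using R by auto
  from usc_on_attains_max[OF usc compact_cball this]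
  obtain m where m: "m \<in> cball x R" "\<And>y. y \<in> cball x R \<Longrightarrow> - v y \<le> - v m" by blast
  \<comment> \<open>On the sphere the paraboloid contributes \<open>k * R\<^sup>2\<close>, one more
    than the largest drop of \<open>v\<close> in the ball, so touching occurs inside.\<close>
  define k where "k = (v x - v m + 1) / R\<^sup>2"
  have k0: "k \<ge> 0" using m(2)[of x] R(1) by (simp add: k_def)
  have "- v y + (- 2 * k) / 2 * R\<^sup>2 < - v x" if "norm (y - x) = R" for y
  proof -
    have "- 2 * k / 2 * R\<^sup>2 = v m - v x - 1" using R(1) by (simp add: k_def)
    then show ?thesis using m(2)[of y] that by (simp add: dist_norm norm_minus_commute)
  qed
  from usc_paraboloid_maximizer[OF usc R(1) this] obtain z e \<alpha> where
    z: "z \<in> ball x R" "- v z \<ge> - v x - (- 2 * k) / 2 * (norm (z - x))\<^sup>2" "norm e = 1"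
    "touched_above (\<lambda>y. - v y) z e \<alpha> 0 (- (- 2 * k))" by blast
  have "k * (norm (z - x))\<^sup>2 \<ge> 0" using k0 by simp
  with z(2) have "v z \<le> v x" by simp
  moreover have "obs z \<le> v z"
    using z(1) R(2) by (intro obstacle_super_touched(2)[OF sup _ z(3) _ z(4)]) auto
  moreover have "v x < obs z" using big z(1) by auto
  ultimately show False by linarith
qed

lemma usc_on_affine:
  assumes "usc_on S u" "a > 0"
  shows "usc_on S (\<lambda>y. a * u y + b)"
  unfolding usc_on_def
proof (intro ballI allI impI)
  fix x and \<epsilon> :: real assume x: "x \<in> S" "\<epsilon> > 0"
  have "\<epsilon> / a > 0" using x assms by simp
  then obtain d where d: "d > 0" "\<forall>y\<in>S. dist y x < d \<longrightarrow> u y < u x + \<epsilon> / a"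
    using assms(1) x(1) unfolding usc_on_def by blast
  have "u y < u x + \<epsilon> / a \<longleftrightarrow> a * u y + b < a * u x + b + \<epsilon>" for y
    using assms(2) by (simp add: field_simps)
  with d show "\<exists>\<delta>>0. \<forall>y\<in>S. dist y x < \<delta> \<longrightarrow> a * u y + b < a * u x + b + \<epsilon>" by auto
qed

theorem theorem5p4:
  fixes \<Omega> :: "(real^'d) set"
    and f obs w v :: "real^'d \<Rightarrow> real"
    and g :: "real^'d \<Rightarrow> real"
  assumes dom: "bounded_domain_cb \<Omega>"
    and RHS1: "continuous_on \<Omega> f" "bounded (f ` \<Omega>)"
    and RHS2: "(SUP x\<in>\<Omega>. f x) < 0 \<or> (INF x\<in>\<Omega>. f x) > 0 \<or> (\<forall>x\<in>\<Omega>. f x = 0)"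
    and g_cont: "continuous_on (frontier \<Omega>) g"
    and OBS1: "continuous_on (closure \<Omega>) obs" "\<forall>x\<in>frontier \<Omega>. obs x < g x"
    and sub: "obstacle_sub \<Omega> f obs w"
    and super: "obstacle_super \<Omega> f obs v"
    and bdry: "\<forall>x\<in>frontier \<Omega>. w x \<le> v x"
  shows "\<forall>x\<in>\<Omega>. w x \<le> v x"
proof (rule ccontr)
  assume "\<not> ?thesis"
  then obtain x1 where x1: "x1 \<in> \<Omega>" "v x1 < w x1" by auto
  have \<Omega>: "open \<Omega>" "bounded \<Omega>" using dom by (auto simp: bounded_domain_cb_def)
  define K where "K = closure \<Omega>"
  have K: "compact K" "K \<noteq> {}" "\<Omega> \<subseteq> K" "frontier \<Omega> \<subseteq> K"
    using \<Omega> x1 closure_subset[of \<Omega>] by (auto simp: K_def frontier_def)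
  have w: "usc_on K w" using sub by (simp add: obstacle_sub_def K_def)
  have v: "usc_on K (\<lambda>y. - v y)" using super by (simp add: obstacle_super_def lsc_on_uminus K_def)
  have obs_v: "obs x \<le> v x" if "x \<in> \<Omega>" for x
    using obstacle_le_super[OF super \<Omega>(1) _ that] OBS1(1) closure_subset
    by (blast intro: continuous_on_subset)
  have isub: "inf_sub_at w y (f y)" if "y \<in> \<Omega>" "obs y < w y" for y
    using obstacle_sub_inf_sub_at[OF sub that] .
  have isup: "inf_sub_at (\<lambda>y. - v y) y (- f y)" if "y \<in> \<Omega>" for y
    using obstacle_super_touched(1)[OF super that] unfolding inf_sub_at_def by blast
  obtain C where C: "\<And>x. x \<in> \<Omega> \<Longrightarrow> \<bar>f x\<bar> \<le> C"
    using RHS1(2) by (auto simp: bounded_iff)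
  have bdd: "bdd_above (f ` \<Omega>)" "bdd_below (f ` \<Omega>)"
    using bounded_imp_bdd_above[OF RHS1(2)] bounded_imp_bdd_below[OF RHS1(2)] .
  define gap where "gap = w x1 - v x1"
  have gap: "gap > 0" using x1 by (simp add: gap_def)
  note comparison = doubling_comparison[OF \<Omega>(2,1), folded K_def]
  from RHS2 show False
  proof (elim disjE)
    assume "\<forall>x\<in>\<Omega>. f x = 0"
    then have "w x1 \<le> v x1"
      using comparison[OF w v bdry OBS1(1)[folded K_def] obs_v RHS1(1) RHS1(1) C isub isup _ x1(1)]
      by blast
    with x1 show False by simp
  next
    assume neg: "(SUP x\<in>\<Omega>. f x) < 0"
    obtain m where m: "m \<in> K" "\<And>y. y \<in> K \<Longrightarrow> w y \<le> w m"
      using usc_on_attains_max[OF w K(1,2)] by blast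
    \<comment> \<open>Small enough that the rescaled \<open>w'\<close> still exceeds
      \<open>v\<close> at \<open>x1\<close>; the 1 keeps the denominator positive.\<close>
    define \<eta> where "\<eta> = gap / (w m - w x1 + 1)"
    have D: "w m - w x1 \<ge> 0" using m(2) x1 K(3) by auto
    then have \<eta>: "\<eta> > 0" using gap by (simp add: \<eta>_def)
    have \<eta>gap: "\<eta> * (w m - w x1) < gap" using D gap by (simp add: \<eta>_def field_simps)
    \<comment> \<open>Subtracting \<eta> times the maximum gives \<open>w' \<le> w\<close>. Boundary
      order is kept, points with \<open>w'\<close> above the obstacle have \<open>w\<close> above
      it, and \<eta> sup f < 0 opens the gap.\<close>
    define w' where "w' y = (1 + \<eta>) * w y + (- \<eta> * w m)" for y
    have w'w: "w' y \<le> w y" if "y \<in> K" for y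
      using mult_left_mono[OF m(2)[OF that], of \<eta>] \<eta> by (simp add: w'_def algebra_simps)
    have "w' x1 \<le> v x1"
    proof (rule comparison[OF _ v _ OBS1(1)[folded K_def] obs_v _ RHS1(1) _ _ isup _ x1(1)])
      show "usc_on K w'" unfolding w'_def using \<eta> by (intro usc_on_affine w) auto
      show "\<forall>x\<in>frontier \<Omega>. w' x \<le> v x" using w'w bdry K(4) by force
      show "continuous_on \<Omega> (\<lambda>x. (1 + \<eta>) * f x)" by (intro continuous_intros RHS1)
      show "\<bar>(1 + \<eta>) * f x\<bar> \<le> (1 + \<eta>) * C" if "x \<in> \<Omega>" for x
        using C[OF that] \<eta> by (simp add: abs_mult)
      show "inf_sub_at w' y ((1 + \<eta>) * f y)" if "y \<in> \<Omega>" "obs y < w' y" for y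
      proof -
        have "y \<in> K" using that K(3) by auto
        then have "obs y < w y" using w'w that(2) by force
        then show ?thesis unfolding w'_def using \<eta> that(1) by (intro inf_sub_at_affine isub) auto
      qed
      have "(1 + \<eta>) * f x + \<eta> * - (SUP x\<in>\<Omega>. f x) \<le> f x" if "x \<in> \<Omega>" for x
        using mult_left_mono[OF cSUP_upper[OF that bdd(1)], of \<eta>] \<eta> by (simp add: algebra_simps)
      moreover have "\<eta> * - (SUP x\<in>\<Omega>. f x) > 0" using neg \<eta> by (intro mult_pos_pos) auto
      ultimately show "(\<exists>\<delta>>0. \<forall>x\<in>\<Omega>. (1 + \<eta>) * f x + \<delta> \<le> f x) \<or> (\<forall>x\<in>\<Omega>. (1 + \<eta>) * f x = 0 \<and> f x = 0)"
        by blast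
    qed
    then show False using \<eta>gap by (simp add: w'_def gap_def algebra_simps)
  next
    assume pos: "(INF x\<in>\<Omega>. f x) > 0"
    obtain m where m: "m \<in> K" "\<And>y. y \<in> K \<Longrightarrow> v m \<le> v y"
      using usc_on_attains_max[OF v K(1,2)] by auto
    define \<eta> where "\<eta> = gap / (v x1 - v m + 1)"
    have D: "v x1 - v m \<ge> 0" using m(2) x1 K(3) by auto
    then have \<eta>: "\<eta> > 0" using gap by (simp add: \<eta>_def)
    have \<eta>gap: "\<eta> * (v x1 - v m) < gap" using D gap by (simp add: \<eta>_def field_simps)
    \<comment> \<open>The mirror construction: subtracting \<eta> times the minimum gives
      \<open>v \<le> v'\<close>, which keeps the boundary and obstacle inequalities, while \<eta>
      inf f > 0 is the gap.\<close>
    define v' where "v' y = (1 + \<eta>) * v y - \<eta> * v m" for y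
    have v'v: "v y \<le> v' y" if "y \<in> K" for y
      using mult_left_mono[OF m(2)[OF that], of \<eta>] \<eta> by (simp add: v'_def algebra_simps)
    have v'_eq: "(\<lambda>y. - v' y) = (\<lambda>y. (1 + \<eta>) * (- v y) + \<eta> * v m)"
      by (simp add: v'_def fun_eq_iff)
    have "w x1 \<le> v' x1"
    proof (rule comparison[OF w _ _ OBS1(1)[folded K_def] _ RHS1(1) _ C isub _ _ x1(1)])
      show "usc_on K (\<lambda>y. - v' y)" unfolding v'_eq using \<eta> by (intro usc_on_affine v) auto
      show "\<forall>x\<in>frontier \<Omega>. w x \<le> v' x" using v'v bdry K(4) by force
      show "obs x \<le> v' x" if "x \<in> \<Omega>" for x using obs_v[OF that] v'v[of x] K(3) that by auto
      show "continuous_on \<Omega> (\<lambda>x. (1 + \<eta>) * f x)" by (intro continuous_intros RHS1)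
      show "inf_sub_at (\<lambda>y. - v' y) y (- ((1 + \<eta>) * f y))" if "y \<in> \<Omega>" for y
        using inf_sub_at_affine[OF _ isup[OF that], of "1 + \<eta>" "\<eta> * v m"] \<eta> unfolding v'_eq by simp
      have "f x + \<eta> * (INF x\<in>\<Omega>. f x) \<le> (1 + \<eta>) * f x" if "x \<in> \<Omega>" for x
        using mult_left_mono[OF cINF_lower[OF bdd(2) that], of \<eta>] \<eta> by (simp add: algebra_simps)
      moreover have "\<eta> * (INF x\<in>\<Omega>. f x) > 0" using pos \<eta> by (intro mult_pos_pos) auto
      ultimately show "(\<exists>\<delta>>0. \<forall>x\<in>\<Omega>. f x + \<delta> \<le> (1 + \<eta>) * f x) \<or> (\<forall>x\<in>\<Omega>. f x = 0 \<and> (1 + \<eta>) * f x = 0)"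
        by blast
    qed
    then show False using \<eta>gap by (simp add: v'_def gap_def algebra_simps)
  qed
qed

end
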